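(* Let $n\ge 0$ be an integer. If $n$ is even, then $$\Delta(B_{\bar 0}^{(n)})=\sum_{r=0}^{n}B_{\bar 0}^{(n-r)}\otimes\Big(\sum_{c=0}^{\lfloor r/2\rfloor}\sum_{a=0}^{r-2c}q^{\binom{2c}{2}+(r-2c)(r-n)-a(r-2c-a)}(q\varsigma)^c\,\check{E}^{(a)}\begin{bmatrix}h;-\lfloor\frac{r-2}{2}\rfloor\\ c\end{bmatrix}K^{r-n}F^{(r-2c-a)}\Big).$$ If $n$ is odd, then $$\Delta(B_{\bar 0}^{(n)})=\sum_{r=0}^{n}B_{\bar 0}^{(n-r)}\otimes\Big(\sum_{c=0}^{\lfloor r/2\rfloor}\sum_{a=0}^{r-2c}q^{\binom{2c+1}{2}+(r-2c)(r-n)-a(r-2c-a)}(q\varsigma)^c\,\check{E}^{(a)}\begin{bmatrix}h;-\lfloor\frac{r-1}{2}\rfloor\\ c\end{bmatrix}K^{r-n}F^{(r-2c-a)}\Big).$$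
   Context: The base field is $\mathbb{Q}(q)$, $q$ an indeterminate, and $\varsigma\in\mathbb{Q}(q)^\times$ is a fixed parameter. Quantum integers: $[n]=\frac{q^n-q^{-n}}{q-q^{-1}}$ for $n\in\mathbb{Z}$, $[n]!=[1][2]\cdots[n]$ (with $[0]!=1$). In exponents of $q$, $\binom{m}{2}=m(m-1)/2$ is the ordinary binomial coefficient. $\lfloor x\rfloor$ is the largest integer $\le x$ (e.g. $\lfloor -1/2\rfloor=-1$). $\mathbf{U}$ is the quantum group of $\mathfrak{sl}_2$ over $\mathbb{Q}(q)$ with generators $E,F,K^{\pm1}$ and relations $KE=q^2EK$, $KF=q^{-2}FK$, $EF-FE=\frac{K-K^{-1}}{q-q^{-1}}$. The comultiplication is the algebra homomorphism $\Delta:\mathbf{U}\to\mathbf{U}\otimes\mathbf{U}$ with $\Delta(E)=E\otimes1+K\otimes E$, $\Delta(F)=1\otimes F+F\otimes K^{-1}$, $\Delta(K)=K\otimes K$. Put $\check{E}=\varsigma EK^{-1}$, $B=F+\check{E}$, $\check{E}^{(a)}=\check{E}^a/[a]!$, $F^{(a)}=F^a/[a]!$, and for $a\in\mathbb{Z}$, $n\ge0$, $$\begin{bmatrix}h;a\\ n\end{bmatrix}=\prod_{i=1}^{n}\frac{q^{4a+4i-4}K^{-2}-1}{q^{4i}-1}\in\mathbf{U}$$ (equal to $1$ for $n=0$). The $\imath$-divided powers of parity $\bar 0$ are defined for $n\in\mathbb{N}=\{0,1,2,\dots\}$ by $$B_{\bar 0}^{(n)}=\frac{1}{[n]!}\begin{cases}B\prod_{j=1}^{k}(B^2-q\varsigma[2j]^2)&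 n=2k+1,\\ \prod_{j=1}^{k}(B^2-q\varsigma[2j-2]^2)& n=2k.\end{cases}$$ *)

theory Defs
  imports
    "HOL-Library.Poly_Mapping"
    "HOL-Computational_Algebra.Fraction_Field"
    "HOL-Computational_Algebra.Polynomial"
begin

section \<open>The base field and quantum integers\<close>

type_synonym Qq = "rat poly fract"

definition q :: Qq where
  "q = Fraction_Field.Fract [:0, 1:] 1"

definition qint :: "int \<Rightarrow> Qq" where
  "qint n = (q powi n - q powi (- n)) / (q - q powi (- 1))"

definition qfact :: "nat \<Rightarrow> Qq" where
  "qfact n = (\<Prod>i = 1..n. qint (int i))"


section \<open>Unital associative algebras over the base field\<close>

text \<open>The zero algebra is not excluded, hence \<open>ring + monoid_mult\<close> rather than \<open>ring_1\<close>.\<close>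

class Qq_algebra = ring + monoid_mult +
  fixes scaleq :: "Qq \<Rightarrow> 'a \<Rightarrow> 'a" (infixr \<open>\<cdot>\<close> 75)
  assumes scaleq_add_right: "c \<cdot> (x + y) = c \<cdot> x + c \<cdot> y"
    and scaleq_add_left: "(c + d) \<cdot> x = c \<cdot> x + d \<cdot> x"
    and scaleq_scaleq: "c \<cdot> d \<cdot> x = (c * d) \<cdot> x"
    and scaleq_one: "1 \<cdot> x = x"
    and mult_scaleq_left: "(c \<cdot> x) * y = c \<cdot> (x * y)"
    and mult_scaleq_right: "x * (c \<cdot> y) = c \<cdot> (x * y)"

definition algebra_hom :: "('a::Qq_algebra \<Rightarrow> 'b::Qq_algebra) \<Rightarrow> bool" where
  "algebra_hom f \<longleftrightarrow>
     (\<forall>x y. f (x + y) = f x + f y) \<and> (\<forall>c x. f (c \<cdot> x) = c \<cdot> f x) \<and>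
     (\<forall>x y. f (x * y) = f x * f y) \<and> f 1 = 1"

inductive_set ideal_gen :: "'a::ring_1 set \<Rightarrow> 'a set" for R where
  ideal_gen_zero: "0 \<in> ideal_gen R"
| ideal_gen_base: "x \<in> R \<Longrightarrow> x \<in> ideal_gen R"
| ideal_gen_add: "x \<in> ideal_gen R \<Longrightarrow> y \<in> ideal_gen R \<Longrightarrow> x + y \<in> ideal_gen R"
| ideal_gen_left: "x \<in> ideal_gen R \<Longrightarrow> a * x \<in> ideal_gen R"
| ideal_gen_right: "x \<in> ideal_gen R \<Longrightarrow> x * a \<in> ideal_gen R"

lemma ideal_gen_uminus: "x \<in> ideal_gen R \<Longrightarrow> - x \<in> ideal_gen R"
  by (subst mult_minus1[symmetric]) (rule ideal_gen_left)

lemma ideal_gen_diff: "x \<in> ideal_gen R \<Longrightarrow> y \<in> ideal_gen R \<Longrightarrow> x - y \<in> ideal_gen R"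
  unfolding diff_conv_add_uminus by (intro ideal_gen_add ideal_gen_uminus)

lemma equivp_ideal_gen: "equivp (\<lambda>x y. x - y \<in> ideal_gen R)"
proof (rule equivpI)
  show "reflp (\<lambda>x y. x - y \<in> ideal_gen R)"
    by (rule reflpI) (simp add: ideal_gen_zero)
  show "symp (\<lambda>x y. x - y \<in> ideal_gen R)"
  proof (rule sympI)
    fix x y assume "x - y \<in> ideal_gen R"
    from ideal_gen_uminus[OF this] show "y - x \<in> ideal_gen R" by simp
  qed
  show "transp (\<lambda>x y. x - y \<in> ideal_gen R)"
  proof (rule transpI)
    fix x y z assume "x - y \<in> ideal_gen R" "y - z \<in> ideal_gen R"
    from ideal_gen_add[OF this] show "x - z \<in> ideal_gen R" by simp
  qed
qed

lemma ideal_gen_cong_add: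
  assumes "x - x' \<in> ideal_gen R" "y - y' \<in> ideal_gen R"
  shows "(x + y) - (x' + y') \<in> ideal_gen R"
  using ideal_gen_add[OF assms] by (simp only: add_diff_add)

lemma ideal_gen_cong_uminus:
  assumes "x - x' \<in> ideal_gen R"
  shows "(- x) - (- x') \<in> ideal_gen R"
  using ideal_gen_uminus[OF assms] by (simp only: minus_diff_minus)

lemma ideal_gen_cong_diff:
  assumes "x - x' \<in> ideal_gen R" "y - y' \<in> ideal_gen R"
  shows "(x - y) - (x' - y') \<in> ideal_gen R"
  using ideal_gen_cong_add[OF assms(1) ideal_gen_cong_uminus[OF assms(2)]] by simp

lemma ideal_gen_cong_mult:
  assumes "x - x' \<in> ideal_gen R" "y - y' \<in> ideal_gen R"
  shows "x * y - x' * y' \<in> ideal_gen R"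
proof -
  have "x * y - x' * y' = (x - x') * y + x' * (y - y')" by (simp add: algebra_simps)
  then show ?thesis using assms by (simp add: ideal_gen_add ideal_gen_left ideal_gen_right)
qed

text \<open>Multiplication in \<open>'m \<Rightarrow>\<^sub>0 Qq\<close> is the convolution along the (additively written)
  monoid \<open>'m\<close>, so \<open>'m \<Rightarrow>\<^sub>0 Qq\<close> is the monoid algebra of \<open>'m\<close>.\<close>

abbreviation const :: "Qq \<Rightarrow> 'm::monoid_add \<Rightarrow>\<^sub>0 Qq" where
  "const c \<equiv> Poly_Mapping.single 0 c"

lemma poly_mapping_single_induct:
  assumes "P 0" "\<And>f w c. P f \<Longrightarrow> P (f + Poly_Mapping.single w c)"
  shows "P x"
proof (induction x rule: update_induct)
  case const
  then show ?case using assms by simp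
next
  case (update f a b)
  have "Poly_Mapping.update a b f = f + Poly_Mapping.single a b"
    using update by (intro poly_mapping_eqI)
      (auto simp: lookup_add lookup_single lookup_update in_keys_iff when_def)
  then show ?case using update assms by simp
qed

lemma const_commute: "const c * x = x * const c" for x :: "'m::monoid_add \<Rightarrow>\<^sub>0 Qq"
proof (induction x rule: poly_mapping_single_induct)
  case 1
  show ?case by simp
next
  case (2 f w d)
  have "const c * Poly_Mapping.single w d = Poly_Mapping.single w d * const c"
    by (simp add: mult_single mult.commute)
  then show ?case by (simp only: distrib_left distrib_right 2)
qed

lemma const_left_commute: "x * (const c * y) = const c * (x * y)"
  for x :: "'m::monoid_add \<Rightarrow>\<^sub>0 Qq"
  by (simp only: mult.assoc[symmetric] const_commute[of c x])


section \<open>The quantum group of \<open>sl\<^sub>2\<close>\<close>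

datatype gen = GenE | GenF | GenK | GenK'

text \<open>The free monoid on the generators, written additively.\<close>

datatype word = Word (letters: "gen list")

instantiation word :: monoid_add
begin
definition "0 = Word []"
definition "v + w = Word (letters v @ letters w)"
instance by standard (auto simp: zero_word_def plus_word_def)
end

type_synonym free_alg = "word \<Rightarrow>\<^sub>0 Qq"

abbreviation X :: "gen \<Rightarrow> free_alg" where
  "X g \<equiv> Poly_Mapping.single (Word [g]) 1"

definition U_relations :: "free_alg set" where
  "U_relations =
     {X GenK * X GenK' - 1,
      X GenK' * X GenK - 1,
      X GenK * X GenE - const (q powi 2) * (X GenE * X GenK),
      X GenK * X GenF - const (q powi (- 2)) * (X GenF * X GenK),
      X GenE * X GenF - X GenF * X GenE
        - const (1 / (q - q powi (- 1))) * (X GenK - X GenK')}"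

quotient_type U = free_alg / "\<lambda>x y. x - y \<in> ideal_gen U_relations"
  by (rule equivp_ideal_gen)

instantiation U :: Qq_algebra
begin

lift_definition zero_U :: U is 0 .
lift_definition one_U :: U is 1 .
lift_definition plus_U :: "U \<Rightarrow> U \<Rightarrow> U" is "(+)" by (rule ideal_gen_cong_add)
lift_definition minus_U :: "U \<Rightarrow> U \<Rightarrow> U" is "(-)" by (rule ideal_gen_cong_diff)
lift_definition uminus_U :: "U \<Rightarrow> U" is uminus by (rule ideal_gen_cong_uminus)
lift_definition times_U :: "U \<Rightarrow> U \<Rightarrow> U" is "(*)" by (rule ideal_gen_cong_mult)
lift_definition scaleq_U :: "Qq \<Rightarrow> U \<Rightarrow> U" is "\<lambda>c x. const c * x"
  by (rule ideal_gen_cong_mult) (simp_all add: ideal_gen_zero)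

instance
proof
  fix a b c :: U and s t :: Qq
  show "a + b + c = a + (b + c)" by transfer (simp add: add.assoc ideal_gen_zero)
  show "a + b = b + a" by transfer (simp add: add.commute ideal_gen_zero)
  show "0 + a = a" by transfer (simp add: ideal_gen_zero)
  show "- a + a = 0" by transfer (simp add: ideal_gen_zero)
  show "a - b = a + - b" by transfer (simp add: ideal_gen_zero)
  show "a * b * c = a * (b * c)" by transfer (simp add: mult.assoc ideal_gen_zero)
  show "(a + b) * c = a * c + b * c" by transfer (simp add: distrib_right ideal_gen_zero)
  show "a * (b + c) = a * b + a * c" by transfer (simp add: distrib_left ideal_gen_zero)
  show "1 * a = a" by transfer (simp add: ideal_gen_zero)
  show "a * 1 = a" by transfer (simp add: ideal_gen_zero)
  show "s \<cdot> (a + b) = s \<cdot> a + s \<cdot> b" by transfer (simp add: distrib_left ideal_gen_zero)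
  show "(s + t) \<cdot> a = s \<cdot> a + t \<cdot> a"
    by transfer (simp add: distrib_right single_add ideal_gen_zero)
  show "s \<cdot> t \<cdot> a = (s * t) \<cdot> a"
    by transfer (simp add: mult.assoc[symmetric] mult_single ideal_gen_zero)
  show "1 \<cdot> a = a" by transfer (simp add: ideal_gen_zero)
  show "(s \<cdot> a) * b = s \<cdot> (a * b)" by transfer (simp add: mult.assoc ideal_gen_zero)
  show "a * (s \<cdot> b) = s \<cdot> (a * b)"
    by transfer (simp add: const_left_commute ideal_gen_zero)
qed

end

lift_definition E :: U is "X GenE" .
lift_definition F :: U is "X GenF" .
lift_definition K :: U is "X GenK" .
lift_definition Kinv :: U is "X GenK'" .

definition Kpow :: "int \<Rightarrow> U" where
  "Kpow m = (if m \<ge> 0 then K ^ nat m else Kinv ^ nat (- m))"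


section \<open>Tensor products of algebras\<close>

text \<open>The product \<open>A \<times> B\<close> of the multiplicative monoids of two algebras, written additively
  so that its monoid algebra is again a type of polynomial mappings.\<close>

datatype ('a, 'b) pure_tensor = PTensor 'a 'b

instantiation pure_tensor :: (monoid_mult, monoid_mult) monoid_add
begin
definition "0 = PTensor 1 1"
fun plus_pure_tensor where "PTensor a b + PTensor c d = PTensor (a * c) (b * d)"
instance
proof
  fix x y z :: "('a, 'b) pure_tensor"
  show "x + y + z = x + (y + z)" by (cases x; cases y; cases z) (simp add: mult.assoc)
  show "0 + x = x" by (cases x) (simp add: zero_pure_tensor_def)
  show "x + 0 = x" by (cases x) (simp add: zero_pure_tensor_def)
qed
end

abbreviation pt :: "'a \<Rightarrow> 'b \<Rightarrow> ('a, 'b) pure_tensor \<Rightarrow>\<^sub>0 Qq" where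
  "pt a b \<equiv> Poly_Mapping.single (PTensor a b) 1"

text \<open>The bilinearity relations. The set is closed under left and right multiplication by
  basis elements up to scalars, so its linear span is already a two-sided ideal.\<close>

definition tensor_relations :: "(('a::Qq_algebra, 'b::Qq_algebra) pure_tensor \<Rightarrow>\<^sub>0 Qq) set" where
  "tensor_relations =
     {pt (a + a') b - pt a b - pt a' b | a a' b. True} \<union>
     {pt a (b + b') - pt a b - pt a b' | a b b'. True} \<union>
     {pt (c \<cdot> a) b - const c * pt a b | c a b. True} \<union>
     {pt a (c \<cdot> b) - const c * pt a b | c a b. True}"

quotient_type (overloaded) ('a, 'b) tensor =
  "('a::Qq_algebra, 'b::Qq_algebra) pure_tensor \<Rightarrow>\<^sub>0 Qq"
  / "\<lambda>x y. x - y \<in> ideal_gen tensor_relations"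
  by (rule equivp_ideal_gen)

instantiation tensor :: (Qq_algebra, Qq_algebra) Qq_algebra
begin

lift_definition zero_tensor :: "('a, 'b) tensor" is 0 .
lift_definition one_tensor :: "('a, 'b) tensor" is 1 .
lift_definition plus_tensor :: "('a, 'b) tensor \<Rightarrow> ('a, 'b) tensor \<Rightarrow> ('a, 'b) tensor"
  is "(+)" by (rule ideal_gen_cong_add)
lift_definition minus_tensor :: "('a, 'b) tensor \<Rightarrow> ('a, 'b) tensor \<Rightarrow> ('a, 'b) tensor"
  is "(-)" by (rule ideal_gen_cong_diff)
lift_definition uminus_tensor :: "('a, 'b) tensor \<Rightarrow> ('a, 'b) tensor"
  is uminus by (rule ideal_gen_cong_uminus)
lift_definition times_tensor :: "('a, 'b) tensor \<Rightarrow> ('a, 'b) tensor \<Rightarrow> ('a, 'b) tensor"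
  is "(*)" by (rule ideal_gen_cong_mult)
lift_definition scaleq_tensor :: "Qq \<Rightarrow> ('a, 'b) tensor \<Rightarrow> ('a, 'b) tensor"
  is "\<lambda>c x. const c * x"
  by (rule ideal_gen_cong_mult) (simp_all add: ideal_gen_zero)

instance
proof
  fix a b c :: "('a, 'b) tensor" and s t :: Qq
  show "a + b + c = a + (b + c)" by transfer (simp add: add.assoc ideal_gen_zero)
  show "a + b = b + a" by transfer (simp add: add.commute ideal_gen_zero)
  show "0 + a = a" by transfer (simp add: ideal_gen_zero)
  show "- a + a = 0" by transfer (simp add: ideal_gen_zero)
  show "a - b = a + - b" by transfer (simp add: ideal_gen_zero)
  show "a * b * c = a * (b * c)" by transfer (simp add: mult.assoc ideal_gen_zero)
  show "(a + b) * c = a * c + b * c" by transfer (simp add: distrib_right ideal_gen_zero)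
  show "a * (b + c) = a * b + a * c" by transfer (simp add: distrib_left ideal_gen_zero)
  show "1 * a = a" by transfer (simp add: ideal_gen_zero)
  show "a * 1 = a" by transfer (simp add: ideal_gen_zero)
  show "s \<cdot> (a + b) = s \<cdot> a + s \<cdot> b" by transfer (simp add: distrib_left ideal_gen_zero)
  show "(s + t) \<cdot> a = s \<cdot> a + t \<cdot> a"
    by transfer (simp add: distrib_right single_add ideal_gen_zero)
  show "s \<cdot> t \<cdot> a = (s * t) \<cdot> a"
    by transfer (simp add: mult.assoc[symmetric] mult_single ideal_gen_zero)
  show "1 \<cdot> a = a" by transfer (simp add: ideal_gen_zero)
  show "(s \<cdot> a) * b = s \<cdot> (a * b)" by transfer (simp add: mult.assoc ideal_gen_zero)
  show "a * (s \<cdot> b) = s \<cdot> (a * b)"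
    by transfer (simp add: const_left_commute ideal_gen_zero)
qed

end

lift_definition tensor_elem :: "'a::Qq_algebra \<Rightarrow> 'b::Qq_algebra \<Rightarrow> ('a, 'b) tensor"
  (infixr \<open>\<otimes>\<close> 72) is pt .

lemma tensor_add_left: "(a + a') \<otimes> b = a \<otimes> b + a' \<otimes> b"
  by transfer (rule ideal_gen_base, unfold tensor_relations_def diff_diff_eq[symmetric], blast)

lemma tensor_add_right: "a \<otimes> (b + b') = a \<otimes> b + a \<otimes> b'"
  by transfer (rule ideal_gen_base, unfold tensor_relations_def diff_diff_eq[symmetric], blast)

lemma tensor_scaleq_left: "(c \<cdot> a) \<otimes> b = c \<cdot> (a \<otimes> b)"
  by transfer (rule ideal_gen_base, unfold tensor_relations_def, blast)

lemma tensor_scaleq_right: "a \<otimes> (c \<cdot> b) = c \<cdot> (a \<otimes> b)"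
  by transfer (rule ideal_gen_base, unfold tensor_relations_def, blast)

lemma tensor_mult: "(a \<otimes> b) * (a' \<otimes> b') = (a * a') \<otimes> (b * b')"
  by transfer (simp add: mult_single ideal_gen_zero)

lemma tensor_one: "1 \<otimes> 1 = 1"
  by transfer (simp add: ideal_gen_zero flip: zero_pure_tensor_def)


section \<open>The comultiplication\<close>

definition comult :: "U \<Rightarrow> (U, U) tensor" where
  "comult = (THE \<Delta>. algebra_hom \<Delta> \<and>
     \<Delta> E = E \<otimes> 1 + K \<otimes> E \<and>
     \<Delta> F = 1 \<otimes> F + F \<otimes> Kinv \<and>
     \<Delta> K = K \<otimes> K)"

subsection \<open>Existence and uniqueness\<close>

lemma scaleq_zero_left [simp]: "0 \<cdot> x = (0 :: 'a::Qq_algebra)"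
  using scaleq_add_left[of 0 0 x] by simp

lemma scaleq_zero_right [simp]: "c \<cdot> 0 = (0 :: 'a::Qq_algebra)"
  using scaleq_add_right[of c 0 0] by simp

lemma scaleq_minus_left: "(- c) \<cdot> x = - (c \<cdot> x)" for x :: "'a::Qq_algebra"
  using scaleq_add_left[of "- c" c x] by (simp add: eq_neg_iff_add_eq_0)

lemma scaleq_minus_right: "c \<cdot> (- x) = - (c \<cdot> x)" for x :: "'a::Qq_algebra"
  using scaleq_add_right[of c "- x" x] by (simp add: eq_neg_iff_add_eq_0)

lemma scaleq_diff_right: "c \<cdot> (x - y) = c \<cdot> x - c \<cdot> y" for x :: "'a::Qq_algebra"
  using scaleq_add_right[of c x "- y"] by (simp add: scaleq_minus_right)

definition lin_ext :: "('m \<Rightarrow> 'a::Qq_algebra) \<Rightarrow> ('m \<Rightarrow>\<^sub>0 Qq) \<Rightarrow> 'a" where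
  "lin_ext m x = (\<Sum>w\<in>Poly_Mapping.keys x. Poly_Mapping.lookup x w \<cdot> m w)"

lemma lin_ext_superset:
  "finite S \<Longrightarrow> Poly_Mapping.keys x \<subseteq> S \<Longrightarrow> lin_ext m x = (\<Sum>w\<in>S. Poly_Mapping.lookup x w \<cdot> m w)"
  unfolding lin_ext_def by (rule sum.mono_neutral_left) (auto simp: in_keys_iff)

lemma lin_ext_add: "lin_ext m (x + y) = lin_ext m x + lin_ext m y"
proof -
  let ?S = "Poly_Mapping.keys x \<union> Poly_Mapping.keys y"
  have "lin_ext m (x + y) = (\<Sum>w\<in>?S. Poly_Mapping.lookup (x + y) w \<cdot> m w)"
    by (rule lin_ext_superset) (use keys_add[of x y] in auto)
  moreover have "lin_ext m x = (\<Sum>w\<in>?S. Poly_Mapping.lookup x w \<cdot> m w)"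
    by (rule lin_ext_superset) auto
  moreover have "lin_ext m y = (\<Sum>w\<in>?S. Poly_Mapping.lookup y w \<cdot> m w)"
    by (rule lin_ext_superset) auto
  ultimately show ?thesis
    by (simp add: lookup_add scaleq_add_left sum.distrib)
qed

lemma lin_ext_single: "lin_ext m (Poly_Mapping.single w c) = c \<cdot> m w"
  by (subst lin_ext_superset[where S = "{w}"]) auto

lemma lin_ext_zero: "lin_ext m 0 = 0"
  by (simp add: lin_ext_def)

lemma lin_ext_diff: "lin_ext m (x - y) = lin_ext m x - lin_ext m y"
  using lin_ext_add[of m "x - y" y] by (simp add: eq_diff_eq)

lemma lin_ext_mult:
  assumes "\<And>v w. m (v + w) = m v * m w"
  shows "lin_ext m (x * y) = lin_ext m x * lin_ext m y"
proof (induction x rule: poly_mapping_single_induct)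
  case 1
  then show ?case by (simp add: lin_ext_zero)
next
  case (2 f w c)
  have "lin_ext m (Poly_Mapping.single w c * y) = (c \<cdot> m w) * lin_ext m y"
  proof (induction y rule: poly_mapping_single_induct)
    case 1
    then show ?case by (simp add: lin_ext_zero)
  next
    case (2 f w' c')
    then show ?case
      by (simp add: distrib_left lin_ext_add mult_single lin_ext_single assms
          mult_scaleq_left mult_scaleq_right scaleq_scaleq mult.commute)
  qed
  then show ?case using 2 by (simp add: distrib_right lin_ext_add lin_ext_single)
qed

lemma lin_ext_ideal:
  assumes "\<And>v w. m (v + w) = m v * m w" "\<And>r. r \<in> R \<Longrightarrow> lin_ext m r = 0"
    and "x \<in> ideal_gen R"
  shows "lin_ext m x = 0"
  using assms(3)
  by induction (simp_all add: lin_ext_zero lin_ext_add lin_ext_mult assms(1,2))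

definition eval_free :: "(gen \<Rightarrow> 'a::Qq_algebra) \<Rightarrow> free_alg \<Rightarrow> 'a" where
  "eval_free g = lin_ext (\<lambda>w. prod_list (map g (letters w)))"

lemma eval_free_X: "eval_free g (X i) = g i"
  by (simp add: eval_free_def lin_ext_single scaleq_one)

lemma eval_free_const: "eval_free g (const c) = c \<cdot> 1"
  by (simp add: eval_free_def lin_ext_single zero_word_def)

lemma eval_free_one: "eval_free g 1 = 1"
  using eval_free_const[of g 1] by (simp add: scaleq_one)

lemma eval_free_add: "eval_free g (x + y) = eval_free g x + eval_free g y"
  by (simp add: eval_free_def lin_ext_add)

lemma eval_free_diff: "eval_free g (x - y) = eval_free g x - eval_free g y"
  by (simp add: eval_free_def lin_ext_diff)

lemma eval_free_mult: "eval_free g (x * y) = eval_free g x * eval_free g y"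
  unfolding eval_free_def by (rule lin_ext_mult) (simp add: plus_word_def)

lemma eval_free_ideal:
  assumes "\<And>r. r \<in> U_relations \<Longrightarrow> eval_free g r = 0" "x \<in> ideal_gen U_relations"
  shows "eval_free g x = 0"
  unfolding eval_free_def
  by (rule lin_ext_ideal[OF _ assms[unfolded eval_free_def]]) (auto simp: plus_word_def)

lemma K_Kinv: "K * Kinv = 1"
  by transfer (rule ideal_gen_base, simp add: U_relations_def)

lemma Kinv_K: "Kinv * K = 1"
  by transfer (rule ideal_gen_base, simp add: U_relations_def)

lemma K_E: "K * E = q powi 2 \<cdot> (E * K)"
  by transfer (rule ideal_gen_base, simp add: U_relations_def)

lemma K_F: "K * F = q powi (- 2) \<cdot> (F * K)"
  by transfer (rule ideal_gen_base, simp add: U_relations_def)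

lemma E_F: "E * F - F * E = (1 / (q - q powi (- 1))) \<cdot> (K - Kinv)"
  by transfer (rule ideal_gen_base, simp add: U_relations_def)

lemma q_nonzero: "q \<noteq> 0"
  by (simp add: q_def eq_fract Zero_fract_def)

theorem U_hom_exists:
  fixes e f k k' :: "'a::Qq_algebra"
  assumes "k * k' = 1" "k' * k = 1"
    and "k * e = q powi 2 \<cdot> (e * k)" "k * f = q powi (- 2) \<cdot> (f * k)"
    and "e * f - f * e = (1 / (q - q powi (- 1))) \<cdot> (k - k')"
  shows "\<exists>h. algebra_hom h \<and> h E = e \<and> h F = f \<and> h K = k \<and> h Kinv = k'"
proof -
  define g where "g = case_gen e f k k'"
  have rel: "eval_free g r = 0" if "r \<in> U_relations" for r
    using that assms unfolding U_relations_def
    by (auto simp: eval_free_diff eval_free_mult eval_free_X eval_free_const eval_free_one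
        g_def mult_scaleq_left simp del: mult_single)
  define h where "h u = eval_free g (rep_U u)" for u
  have h: "h (abs_U x) = eval_free g x" for x
  proof -
    have "rep_U (abs_U x) - x \<in> ideal_gen U_relations"
      using Quotient3_rep_abs[OF Quotient3_U, of x] by (simp add: ideal_gen_zero)
    then have "eval_free g (rep_U (abs_U x) - x) = 0"
      using eval_free_ideal rel by blast
    then show ?thesis by (simp add: h_def eval_free_diff)
  qed
  have ex: "\<exists>x. u = abs_U x" for u
    by (rule exI[of _ "rep_U u"]) (simp only: Quotient3_abs_rep[OF Quotient3_U])
  have "algebra_hom h"
    unfolding algebra_hom_def
  proof (intro conjI allI)
    fix u v :: U and c :: Qq
    obtain x y where uv: "u = abs_U x" "v = abs_U y" using ex by metis
    show "h (u + v) = h u + h v" by (simp add: uv plus_U.abs_eq h eval_free_add)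
    show "h (u * v) = h u * h v" by (simp add: uv times_U.abs_eq h eval_free_mult)
    show "h (c \<cdot> u) = c \<cdot> h u"
      by (simp add: uv scaleq_U.abs_eq h eval_free_mult eval_free_const mult_scaleq_left)
    show "h 1 = 1" by (simp add: one_U_def h eval_free_one)
  qed
  then show ?thesis
    by (intro exI[of _ h])
      (simp add: E_def F_def K_def Kinv_def h eval_free_X g_def)
qed

theorem U_hom_unique:
  assumes h: "algebra_hom h" and h': "algebra_hom h'"
    and eq: "h E = h' E" "h F = h' F" "h K = h' K"
  shows "h = h'"
proof -
  have add: "h (x + y) = h x + h y" "h' (x + y) = h' x + h' y"
    and mult: "h (x * y) = h x * h y" "h' (x * y) = h' x * h' y"
    and scale: "h (c \<cdot> x) = c \<cdot> h x" "h' (c \<cdot> x) = c \<cdot> h' x"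
    and one: "h 1 = 1" "h' 1 = 1" for x y c
    using h h' unfolding algebra_hom_def by auto
  have "h Kinv = h Kinv * (h' K * h' Kinv)"
    by (simp only: mult(2)[symmetric] K_Kinv one mult_1_right)
  also have "\<dots> = (h Kinv * h K) * h' Kinv"
    by (simp only: eq mult.assoc)
  also have "\<dots> = h' Kinv"
    by (simp only: mult(1)[symmetric] Kinv_K one mult_1_left)
  finally have eq': "h Kinv = h' Kinv" .
  have X: "h (abs_U (X i)) = h' (abs_U (X i))" for i
    using eq eq' by (cases i) (simp_all add: E_def F_def K_def Kinv_def)
  have W: "h (abs_U (Poly_Mapping.single (Word ws) 1))
      = h' (abs_U (Poly_Mapping.single (Word ws) 1))" for ws
  proof (induction ws)
    case Nil
    have "Poly_Mapping.single (Word []) 1 = (1 :: free_alg)"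
      by (simp flip: zero_word_def)
    then show ?case by (simp add: one flip: one_U_def)
  next
    case (Cons i ws)
    have "Poly_Mapping.single (Word (i # ws)) 1 = X i * Poly_Mapping.single (Word ws) 1"
      by (simp add: mult_single plus_word_def)
    then have "abs_U (Poly_Mapping.single (Word (i # ws)) 1)
        = abs_U (X i) * abs_U (Poly_Mapping.single (Word ws) 1)"
      by (simp add: times_U.abs_eq)
    then show ?case by (simp only: mult X Cons)
  qed
  have "h (abs_U x) = h' (abs_U x)" for x
  proof (induction x rule: poly_mapping_single_induct)
    case 1
    have "h 0 = 0" "h' 0 = 0" using scale[of 0 0] by simp_all
    then show ?case by (simp flip: zero_U_def)
  next
    case (2 f w c)
    have "Poly_Mapping.single w c = const c * Poly_Mapping.single (Word (letters w)) 1"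
      by (simp add: mult_single)
    then have "abs_U (f + Poly_Mapping.single w c)
        = abs_U f + c \<cdot> abs_U (Poly_Mapping.single (Word (letters w)) 1)"
      by (simp only: plus_U.abs_eq scaleq_U.abs_eq)
    then show ?case using 2 W by (simp only: add scale)
  qed
  then have "h (abs_U (rep_U u)) = h' (abs_U (rep_U u))" for u .
  then show ?thesis
    by (intro ext) (simp only: Quotient3_abs_rep[OF Quotient3_U])
qed

lemma Kinv_E: "Kinv * E = q powi (- 2) \<cdot> (E * Kinv)"
proof -
  have "E * Kinv = Kinv * (K * E) * Kinv"
    by (simp add: Kinv_K flip: mult.assoc)
  also have "\<dots> = q powi 2 \<cdot> (Kinv * E * (K * Kinv))"
    by (simp add: K_E mult_scaleq_left mult_scaleq_right mult.assoc)
  finally have "q powi (- 2) \<cdot> (E * Kinv) = (q powi (- 2) * q powi 2) \<cdot> (Kinv * E)"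
    by (simp add: K_Kinv scaleq_scaleq)
  moreover have "q powi (- 2) * q powi 2 = 1"
    using q_nonzero by (simp add: power_int_minus)
  ultimately show ?thesis by (simp add: scaleq_one)
qed

theorem comult_ex1:
  "\<exists>!\<Delta>. algebra_hom \<Delta> \<and>
     \<Delta> E = E \<otimes> 1 + K \<otimes> E \<and> \<Delta> F = 1 \<otimes> F + F \<otimes> Kinv \<and> \<Delta> K = K \<otimes> K"
proof -
  let ?e = "E \<otimes> 1 + K \<otimes> E" and ?f = "1 \<otimes> F + F \<otimes> Kinv"
  let ?d = "1 / (q - q powi (- 1))"
  note scaleq = tensor_scaleq_left tensor_scaleq_right scaleq_add_right
  note distribs = distrib_left distrib_right tensor_mult
  have 1: "(K \<otimes> K) * (Kinv \<otimes> Kinv) = 1" "(Kinv \<otimes> Kinv) * (K \<otimes> K) = 1"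
    by (simp_all add: tensor_mult K_Kinv Kinv_K tensor_one)
  have 2: "(K \<otimes> K) * ?e = q powi 2 \<cdot> (?e * (K \<otimes> K))"
    by (simp add: distribs K_E scaleq)
  have 3: "(K \<otimes> K) * ?f = q powi (- 2) \<cdot> (?f * (K \<otimes> K))"
    by (simp add: distribs K_F K_Kinv Kinv_K scaleq)
  have "(K * F) \<otimes> (E * Kinv) = (F * K) \<otimes> (Kinv * E)"
    by (simp add: K_F Kinv_E scaleq)
  then have "?e * ?f - ?f * ?e = (E * F - F * E) \<otimes> Kinv + K \<otimes> (E * F - F * E)"
    using tensor_add_left[of "E * F - F * E" "F * E" Kinv]
      tensor_add_right[of K "E * F - F * E" "F * E"]
    by (simp add: distribs algebra_simps)
  also have "\<dots> = ?d \<cdot> ((K - Kinv) \<otimes> Kinv + K \<otimes> (K - Kinv))"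
    by (simp only: E_F scaleq)
  also have "(K - Kinv) \<otimes> Kinv + K \<otimes> (K - Kinv) = K \<otimes> K - Kinv \<otimes> Kinv"
    using tensor_add_left[of "K - Kinv" Kinv Kinv] tensor_add_right[of K "K - Kinv" Kinv]
    by (simp add: algebra_simps)
  finally have 4: "?e * ?f - ?f * ?e = ?d \<cdot> (K \<otimes> K - Kinv \<otimes> Kinv)" .
  from U_hom_exists[OF 1 2 3 4] show ?thesis
    by (elim exE conjE, intro ex_ex1I conjI exI) (assumption | (rule U_hom_unique; simp))+
qed

lemma
  shows comult_hom: "algebra_hom comult"
    and comult_E: "comult E = E \<otimes> 1 + K \<otimes> E"
    and comult_F: "comult F = 1 \<otimes> F + F \<otimes> Kinv"
    and comult_K: "comult K = K \<otimes> K"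
  using theI'[OF comult_ex1] unfolding comult_def by auto

section \<open>The \<open>\<imath>\<close>-divided powers\<close>

definition Echeck :: "Qq \<Rightarrow> U" where
  "Echeck \<sigma> = \<sigma> \<cdot> (E * Kinv)"

definition B :: "Qq \<Rightarrow> U" where
  "B \<sigma> = F + Echeck \<sigma>"

definition divpow :: "U \<Rightarrow> nat \<Rightarrow> U" where
  "divpow x a = (1 / qfact a) \<cdot> x ^ a"

text \<open>\<open>\<sigma>\<close> is the parameter \<open>\<varsigma>\<close>, and \<open>hbinom a n\<close> is the
  bracket \<open>[h; a; n]\<close>. The factors of each product below commute pairwise; \<open>prod_list\<close> is used only
  because the algebra is noncommutative.\<close>

definition hbinom :: "int \<Rightarrow> nat \<Rightarrow> U" where
  "hbinom a n =
     (\<Prod>i\<leftarrow>[1..<Suc n].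
        (1 / (q ^ (4 * i) - 1)) \<cdot> (q powi (4 * a + 4 * int i - 4) \<cdot> Kpow (- 2) - 1))"

definition Bdiv0 :: "Qq \<Rightarrow> nat \<Rightarrow> U" where
  "Bdiv0 \<sigma> n = (1 / qfact n) \<cdot>
     (let k = n div 2 in
      if odd n
      then B \<sigma> * (\<Prod>j\<leftarrow>[1..<Suc k]. (B \<sigma>)\<^sup>2 - (q * \<sigma> * (qint (2 * int j))\<^sup>2) \<cdot> 1)
      else (\<Prod>j\<leftarrow>[1..<Suc k]. (B \<sigma>)\<^sup>2 - (q * \<sigma> * (qint (2 * int j - 2))\<^sup>2) \<cdot> 1))"

end

theory Submission
  imports Defs
begin

text \<open>
  Since \<open>\<Delta>(B) = B \<otimes> K\<^sup>-\<^sup>1 + 1 \<otimes> B\<close> and the \<open>\<imath>\<close>-divided powers satisfy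
  \<open>B B\<^sup>(\<^sup>n\<^sup>) = [n+1] B\<^sup>(\<^sup>n\<^sup>+\<^sup>1\<^sup>) + (q\<varsigma>[n] B\<^sup>(\<^sup>n\<^sup>-\<^sup>1\<^sup>) for even n)\<close>, the right-hand tensor factors of the
  expansion can be computed by induction on \<open>n\<close>. Writing them in the triangular form
  \<open>\<Sum> Echeck\<^sup>(\<^sup>a\<^sup>) g(K\<^sup>-\<^sup>1) F\<^sup>(\<^sup>b\<^sup>)\<close> and commuting \<open>B\<close> and \<open>K\<^sup>-\<^sup>1\<close> past \<open>Echeck\<^sup>(\<^sup>a\<^sup>)\<close> and \<open>g\<close>, the induction step
  reduces, for fixed \<open>(a, b, c)\<close> with \<open>a + b + 2c = r\<close>, to an identity between polynomials in
  \<open>K\<^sup>-\<^sup>1\<close>. After division by their common factors these polynomials are linear in \<open>K\<^sup>-\<^sup>2\<close>, which leaves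
  one identity of rational functions for each combination of the parities of \<open>n\<close> and \<open>r\<close>.
\<close>

section \<open>Polynomials in the inverse of K\<close>

lemma q_power: "q ^ k = Fraction_Field.Fract (monom 1 k) 1"
  by (induction k) (simp_all add: q_def One_fract_def monom_Suc)

text \<open>Powers of the indeterminate are told apart by their degree. This keeps quantum integers
  and bracket denominators away from zero.\<close>

lemma q_power_neq_1: "k > 0 \<Longrightarrow> q ^ k \<noteq> 1"
  by (auto simp: q_power One_fract_def eq_fract dest: arg_cong[where f = degree] simp:
      degree_monom_eq)

lemma q_diff_nonzero: "q - 1 / q \<noteq> 0"
  using q_power_neq_1[of 2] q_nonzero by (simp add: field_simps power2_eq_square)

lemma qint_eq: "qint m = (q powi m - 1 / q powi m) / (q - 1 / q)"
  by (simp add: qint_def power_int_minus divide_inverse)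

lemma qint_0 [simp]: "qint 0 = 0"
  by (simp add: qint_eq)

lemma qint_nonzero: "m > 0 \<Longrightarrow> qint (int m) \<noteq> 0"
  using q_power_neq_1[of "m + m"] q_nonzero q_diff_nonzero
  by (simp add: qint_eq field_simps power_add)

lemma qfact_0 [simp]: "qfact 0 = 1"
  by (simp add: qfact_def)

lemma qfact_Suc: "qfact (Suc n) = qint (int n + 1) * qfact n"
  by (simp add: qfact_def prod.nat_ivl_Suc' ac_simps)

lemma qfact_nonzero: "qfact n \<noteq> 0"
  unfolding qfact_def using qint_nonzero by simp

text \<open>Reduces every exponent to powers of a few atoms such as \<open>q powi int a\<close>, so
  that identities with symbolic exponents become identities of rational functions.\<close>

lemma q_powi_simps:
  "q powi (m + n) = q powi m * q powi n"
  "q powi (m - n) = q powi m / q powi n"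
  "q powi (- m) = 1 / q powi m"
  "q powi (numeral k * m) = (q powi m) ^ numeral k"
  "q powi (m * numeral k) = (q powi m) ^ numeral k"
  using q_nonzero
  by (simp_all add: power_int_add power_int_diff power_int_minus divide_inverse power_int_mult
      mult.commute[of "numeral k" m])

lemma scaleq_sum_right: "c \<cdot> (\<Sum>i\<in>I. f i) = (\<Sum>i\<in>I. c \<cdot> f i)"
  for f :: "'i \<Rightarrow> 'a::Qq_algebra"
  by (induction I rule: infinite_finite_induct) (simp_all add: scaleq_add_right)

lemma tensor_zero_right [simp]: "a \<otimes> 0 = 0"
  using tensor_scaleq_right[of a 0 0] by simp

lemma scaleq_cancel:
  assumes "c \<noteq> 0" "c \<cdot> x = c \<cdot> y"
  shows "x = (y :: 'a::Qq_algebra)"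
proof -
  have "(1 / c) \<cdot> c \<cdot> x = (1 / c) \<cdot> c \<cdot> y" using assms(2) by simp
  then show ?thesis using assms(1) by (simp add: scaleq_scaleq scaleq_one)
qed

section \<open>Evaluation of polynomials at \<open>Kinv\<close>\<close>

definition Kinv_poly :: "Qq poly \<Rightarrow> U" where
  "Kinv_poly p = fold_coeffs (\<lambda>a u. a \<cdot> 1 + Kinv * u) p 0"

lemma Kinv_poly_0 [simp]: "Kinv_poly 0 = 0"
  by (simp add: Kinv_poly_def)

lemma Kinv_poly_pCons: "Kinv_poly (pCons a p) = a \<cdot> 1 + Kinv * Kinv_poly p"
  by (cases "a = 0 \<and> p = 0") (auto simp: Kinv_poly_def)

lemma Kinv_poly_1 [simp]: "Kinv_poly 1 = 1"
  by (simp add: one_pCons Kinv_poly_pCons scaleq_one)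

lemma Kinv_poly_add: "Kinv_poly (p + r) = Kinv_poly p + Kinv_poly r"
  by (induction p r rule: poly_induct2)
    (simp_all add: Kinv_poly_pCons scaleq_add_left distrib_left)

lemma Kinv_poly_smult: "Kinv_poly (smult c p) = c \<cdot> Kinv_poly p"
  by (induction p)
    (simp_all add: Kinv_poly_pCons scaleq_add_right scaleq_scaleq mult_scaleq_right)

text \<open>Evaluation at a single element respects products although \<open>U\<close> is
  noncommutative. Identities between Cartan factors can therefore be checked in the commutative ring
  \<open>Qq poly\<close>.\<close>

lemma Kinv_poly_mult: "Kinv_poly (p * r) = Kinv_poly p * Kinv_poly r"
  by (induction p)
    (simp_all add: Kinv_poly_pCons Kinv_poly_add Kinv_poly_smult distrib_right
      mult_scaleq_left mult.assoc)

lemma Kinv_poly_power: "Kinv_poly (p ^ k) = Kinv_poly p ^ k"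
  by (induction k) (simp_all add: Kinv_poly_mult)

lemma Kinv_poly_X: "Kinv_poly [:0, 1:] = Kinv"
  by (simp add: Kinv_poly_pCons scaleq_one)

lemma Kinv_poly_monom: "Kinv_poly (monom 1 k) = Kinv ^ k"
  by (simp add: Kinv_poly_power Kinv_poly_X monom_altdef)

section \<open>Moving \<open>F\<close> and \<open>Kinv\<close> to the right past
  \<open>Echeck\<close> and Cartan factors\<close>

lemma F_Kinv: "F * Kinv = q powi (- 2) \<cdot> (Kinv * F)"
proof -
  have "Kinv * F = Kinv * F * (K * Kinv)" by (simp add: K_Kinv)
  also have "\<dots> = Kinv * (F * K) * Kinv" by (simp add: mult.assoc)
  also have "F * K = q powi 2 \<cdot> (K * F)"
    using q_nonzero by (simp add: K_F scaleq_scaleq scaleq_one power_int_minus)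
  also have "Kinv * (q powi 2 \<cdot> (K * F)) * Kinv = q powi 2 \<cdot> (Kinv * K * F * Kinv)"
    by (simp add: mult_scaleq_left mult_scaleq_right mult.assoc)
  finally show ?thesis
    using q_nonzero by (simp add: scaleq_scaleq scaleq_one power_int_minus Kinv_K)
qed

text \<open>Each \<open>Kinv\<close> that \<open>F\<close> crosses costs q^(-2), which amounts to
  rescaling the variable.\<close>

lemma F_Kinv_poly: "F * Kinv_poly p = Kinv_poly (pcompose p [:0, q powi (- 2):]) * F"
proof (induction p)
  case (pCons a p)
  let ?p' = "pcompose p [:0, q powi (- 2):]"
  have "F * Kinv_poly (pCons a p) = a \<cdot> F + (F * Kinv) * Kinv_poly p"
    by (simp add: Kinv_poly_pCons distrib_left mult_scaleq_right mult.assoc)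
  also have "(F * Kinv) * Kinv_poly p = q powi (- 2) \<cdot> (Kinv * Kinv_poly ?p' * F)"
    by (simp add: F_Kinv mult_scaleq_left mult.assoc pCons.IH)
  also have "a \<cdot> F + \<dots> = Kinv_poly ([:a:] + [:0, q powi (- 2):] * ?p') * F"
    by (simp add: Kinv_poly_add Kinv_poly_pCons Kinv_poly_smult distrib_right mult_scaleq_left
        mult_scaleq_right)
  finally show ?case by (simp add: pcompose_pCons)
qed simp

lemma Kinv_Echeck: "Kinv * Echeck \<sigma> = q powi (- 2) \<cdot> (Echeck \<sigma> * Kinv)"
proof -
  have "Kinv * Echeck \<sigma> = \<sigma> \<cdot> (Kinv * E * Kinv)"
    by (simp add: Echeck_def mult_scaleq_right mult.assoc)
  then show ?thesis
    by (simp add: Kinv_E Echeck_def mult_scaleq_left scaleq_scaleq mult.assoc mult.commute)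
qed

text \<open>The commutator of E and F, multiplied by \<open>Kinv\<close>, turns K - K^(-1) into 1 -
  K^(-2); hence the Cartan term is a polynomial in \<open>Kinv\<close> alone.\<close>

lemma F_Echeck:
  "F * Echeck \<sigma> = q powi (- 2) \<cdot> (Echeck \<sigma> * F)
     + (\<sigma> / (q - 1 / q)) \<cdot> Kinv_poly [:- 1, 0, 1:]"
proof -
  have 1: "F * E = E * F - (1 / (q - 1 / q)) \<cdot> (K - Kinv)"
    using E_F by (simp add: power_int_minus divide_inverse algebra_simps)
  have "F * Echeck \<sigma> = \<sigma> \<cdot> (F * E * Kinv)"
    by (simp add: Echeck_def mult_scaleq_right mult.assoc)
  also have "F * E * Kinv = E * (F * Kinv) - (1 / (q - 1 / q)) \<cdot> (K * Kinv - Kinv * Kinv)"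
    by (simp only: 1 left_diff_distrib mult_scaleq_left mult.assoc)
  also have "E * (F * Kinv) = q powi (- 2) \<cdot> (E * Kinv * F)"
    by (simp add: F_Kinv mult_scaleq_right mult.assoc)
  also have "K * Kinv - Kinv * Kinv = - Kinv_poly [:- 1, 0, 1:]"
    by (simp add: K_Kinv Kinv_poly_pCons scaleq_one scaleq_minus_left)
  finally show ?thesis
    by (simp add: Echeck_def scaleq_diff_right scaleq_scaleq mult_scaleq_left mult.commute
        scaleq_minus_right scaleq_add_right)
qed

lemma Kinv_Echeck_power: "Kinv * Echeck \<sigma> ^ a = q powi (- 2 * int a) \<cdot> (Echeck \<sigma> ^ a * Kinv)"
proof (induction a)
  case (Suc a)
  have "Kinv * Echeck \<sigma> ^ Suc a = (Kinv * Echeck \<sigma> ^ a) * Echeck \<sigma>"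
    by (simp add: power_Suc2 mult.assoc del: power_Suc)
  also have "\<dots> = q powi (- 2 * int a) \<cdot> (Echeck \<sigma> ^ a * (Kinv * Echeck \<sigma>))"
    by (simp only: Suc mult_scaleq_left mult.assoc)
  also have "\<dots> = (q powi (- 2 * int a) * q powi (- 2)) \<cdot> (Echeck \<sigma> ^ Suc a * Kinv)"
    by (simp only: Kinv_Echeck mult_scaleq_right scaleq_scaleq power_Suc2 mult.assoc)
  also have "q powi (- 2 * int a) * q powi (- 2) = q powi (- 2 * int (Suc a))"
    using q_nonzero by (simp flip: power_int_add add: algebra_simps)
  finally show ?case .
qed (simp add: scaleq_one)

lemma Kinv_poly_2_Echeck_power:
  "Kinv_poly [:u, 0, v:] * Echeck \<sigma> ^ a
     = Echeck \<sigma> ^ a * Kinv_poly [:u, 0, q powi (- 4 * int a) * v:]"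
proof -
  have "q powi (- 2 * int a) * q powi (- 2 * int a) = q powi (- 4 * int a)"
    using q_nonzero by (simp flip: power_int_add)
  then have "Kinv * Kinv * Echeck \<sigma> ^ a = q powi (- 4 * int a) \<cdot> (Echeck \<sigma> ^ a * (Kinv * Kinv))"
    by (simp add: mult.assoc Kinv_Echeck_power mult_scaleq_right scaleq_scaleq)
      (simp add: Kinv_Echeck_power mult_scaleq_left scaleq_scaleq flip: mult.assoc)
  then show ?thesis
    by (simp add: Kinv_poly_pCons distrib_left distrib_right mult_scaleq_left mult_scaleq_right
        scaleq_scaleq mult.commute flip: mult.assoc)
qed

text \<open>Moving \<open>F\<close> through one \<open>Echeck\<close> at a time leaves a + 1 Cartan
  terms. Collecting them behind \<open>Echeck ^ a\<close> gives geometric sums in the coefficients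
  of 1 and K^(-2), equal to q^(-a) [a+1] and q^(-3a) [a+1].\<close>

lemma F_Echeck_power:
  "F * Echeck \<sigma> ^ Suc a = q powi (- 2 * (int a + 1)) \<cdot> (Echeck \<sigma> ^ Suc a * F)
     + (\<sigma> * qint (int a + 1) / (q - 1 / q)) \<cdot>
         (Echeck \<sigma> ^ a * Kinv_poly [:- (q powi (- int a)), 0, q powi (- 3 * int a):])"
proof (induction a)
  case 0
  then show ?case using q_diff_nonzero by (simp add: F_Echeck qint_eq)
next
  case (Suc a)
  let ?E = "Echeck \<sigma>" and ?s = "\<sigma> / (q - 1 / q)" and ?A = "q powi int a"
  let ?p = "[:- (q powi (- int a)), 0, q powi (- 3 * int a):]"
  let ?c = "\<sigma> * qint (int a + 1) / (q - 1 / q)"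
  have E2: "?E ^ Suc (Suc a) = ?E ^ Suc a * ?E" "?E ^ Suc a = ?E ^ a * ?E"
    by (simp_all only: power_Suc2)
  have "F * ?E ^ Suc (Suc a) = (F * ?E ^ Suc a) * ?E"
    by (simp only: E2(1) mult.assoc)
  also have "\<dots> = q powi (- 2 * (int a + 1)) \<cdot> (?E ^ Suc a * (F * ?E))
      + ?c \<cdot> (?E ^ a * (Kinv_poly ?p * ?E ^ 1))"
    by (simp only: Suc distrib_right mult_scaleq_left mult.assoc power_one_right)
  \<comment> \<open>The single factor is kept as a first power so that
    \<open>Kinv_poly_2_Echeck_power\<close> applies with exponent 1.\<close>
  also have "Kinv_poly ?p * ?E ^ 1
      = ?E * Kinv_poly [:- (q powi (- int a)), 0, q powi (- 4) * q powi (- 3 * int a):]"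
    by (subst Kinv_poly_2_Echeck_power) simp
  also have "q powi (- 2 * (int a + 1)) \<cdot> (?E ^ Suc a * (F * ?E)) =
     (q powi (- 2 * (int a + 1)) * q powi (- 2)) \<cdot> (?E ^ Suc (Suc a) * F)
     + ?E ^ Suc a * Kinv_poly (smult (q powi (- 2 * (int a + 1)) * ?s) [:- 1, 0, 1:])"
    by (simp only: F_Echeck E2(1) Kinv_poly_smult distrib_left mult_scaleq_right scaleq_scaleq
        scaleq_add_right mult.assoc)
  also have "q powi (- 2 * (int a + 1)) * q powi (- 2) = q powi (- 2 * (int (Suc a) + 1))"
    using q_nonzero by (simp flip: power_int_add)
  also have "?c \<cdot> (?E ^ a
      * (?E * Kinv_poly [:- (q powi (- int a)), 0, q powi (- 4) * q powi (- 3 * int a):]))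
     = ?E ^ Suc a * Kinv_poly
         (smult ?c [:- (q powi (- int a)), 0, q powi (- 4) * q powi (- 3 * int a):])"
    by (simp only: E2(2) Kinv_poly_smult mult_scaleq_right mult.assoc)
  \<comment> \<open>Each geometric sum grows by one summand: the last term here cancels the Cartan
    term that the new \<open>Echeck\<close> contributes. Facts 1 and 2 below are the constant and
    the quadratic coefficient.\<close>
  also have "smult ?c [:- (q powi (- int a)), 0, q powi (- 4) * q powi (- 3 * int a):] =
      smult (\<sigma> * qint (int (Suc a) + 1) / (q - 1 / q))
          [:- (q powi (- int (Suc a))), 0, q powi (- 3 * int (Suc a)):]
      - smult (q powi (- 2 * (int a + 1)) * ?s) [:- 1, 0, 1:]"
  proof -
    define d A where "d = q - 1 / q" and "A = q powi int a"
    have nz: "d \<noteq> 0" "A \<noteq> 0" and d: "q - 1 / q = d"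
      using q_nonzero q_diff_nonzero by (simp_all add: d_def A_def)
    have 1: "(A * q - 1 / (A * q)) * - (1 / A)
        = (A * q\<^sup>2 - 1 / (A * q\<^sup>2)) * - (1 / (A * q)) + d / (A * q)\<^sup>2"
      unfolding d_def using q_nonzero nz(2) by (simp add: field_simps power2_eq_square)
    have 2: "(A * q - 1 / (A * q)) * (1 / q ^ 4 / A ^ 3)
        = (A * q\<^sup>2 - 1 / (A * q\<^sup>2)) * (1 / (A * q) ^ 3) - d / (A * q)\<^sup>2"
      unfolding d_def using q_nonzero nz(2)
      by (simp add: field_simps power2_eq_square eval_nat_numeral)
    have 3: "q powi (- int a) = 1 / A" "q powi (- 4) * q powi (- 3 * int a) = 1 / q ^ 4 / A ^ 3"
      "q powi (- int (Suc a)) = 1 / (A * q)" "q powi (- 3 * int (Suc a)) = 1 / (A * q) ^ 3"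
      "q powi (- 2 * (int a + 1)) = 1 / (A * q)\<^sup>2"
      "qint (int a + 1) = (A * q - 1 / (A * q)) / d"
      "qint (int (Suc a) + 1) = (A * q\<^sup>2 - 1 / (A * q\<^sup>2)) / d"
      using q_nonzero by (simp_all add: A_def d_def q_powi_simps qint_eq field_simps
          eval_nat_numeral)
    have "smult ?c [:- (q powi (- int a)), 0, q powi (- 4) * q powi (- 3 * int a):]
        = smult (\<sigma> / d / d) [:(A * q - 1 / (A * q)) * - (1 / A), 0,
            (A * q - 1 / (A * q)) * (1 / q ^ 4 / A ^ 3):]"
      unfolding 3 d by simp
    also have "\<dots> = smult (\<sigma> * qint (int (Suc a) + 1) / d)
        [:- (q powi (- int (Suc a))), 0, q powi (- 3 * int (Suc a)):]
      - smult (q powi (- 2 * (int a + 1)) * (\<sigma> / d)) [:- 1, 0, 1:]"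
      unfolding 1 2 3 using nz(1)
          by (simp add: algebra_simps add_divide_distrib diff_divide_distrib)
    finally show ?thesis unfolding d .
  qed
  finally show ?case
   by (simp add: Kinv_poly_add[symmetric] distrib_left[symmetric])
     (simp add: Kinv_poly_smult[symmetric] mult_scaleq_right[symmetric])
qed

section \<open>The scalar identities\<close>

text \<open>The letters \<open>N, \<alpha>, \<beta>, \<gamma>, r\<close> stand for \<open>q\<close> raised to \<open>n, a, b, c\<close> and \<open>a + b + 2c\<close>; the variables
  \<open>u\<close> and \<open>x\<close> keep the coefficients of \<open>1\<close> and \<open>K\<^sup>-\<^sup>2\<close> apart. The first parity in a name is that of \<open>n\<close>,
  the second that of \<open>a + b + 2c\<close>.\<close>

lemma scalar_even_even:
  fixes q N \<alpha> \<beta> \<gamma> x u :: "'a::field"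
  assumes nz: "q \<noteq> 0" "N \<noteq> 0" "\<alpha> \<noteq> 0" "\<beta> \<noteq> 0" "\<gamma> \<noteq> 0"
  defines "r \<equiv> \<alpha> * \<beta> * \<gamma>\<^sup>2"
  shows "(N * q - 1 / (N * q)) * (q ^ 4 / r\<^sup>2 * x - u) =
    (N * q / r - r / (N * q)) / \<alpha>\<^sup>2 * (\<alpha> * \<beta> / \<gamma>\<^sup>2) * (q ^ 4 / r\<^sup>2 * x - u)
    + (N * q\<^sup>2 / r - r / (N * q\<^sup>2)) / \<alpha>\<^sup>2 * (q ^ 3 / \<gamma> ^ 6 / (\<alpha> * \<beta>)) * (\<gamma> ^ 4 - 1) * x
    + (\<alpha> - 1 / \<alpha>) * (N * q / r * \<beta> / \<gamma>\<^sup>2) * (q ^ 4 / r\<^sup>2 * \<gamma> ^ 4 * x - u)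
    + (\<beta> - 1 / \<beta>) / \<alpha>\<^sup>2 * (r / (N * q) * \<alpha> / \<gamma>\<^sup>2) * (q ^ 4 / r\<^sup>2 * x - u)
    + q ^ 3 / \<gamma> ^ 6 * r / (N * q) / \<beta> * (\<gamma> ^ 4 - 1) / q * (x / \<alpha> ^ 3 - u / \<alpha>)
    - (N - 1 / N) * (q / \<gamma> ^ 4) * (\<gamma> ^ 4 - 1) * u"
  unfolding r_def using nz
  by (simp add: divide_simps) (simp add: algebra_simps eval_nat_numeral)

lemma scalar_even_odd:
  fixes q N \<alpha> \<beta> \<gamma> x u :: "'a::field"
  assumes nz: "q \<noteq> 0" "N \<noteq> 0" "\<alpha> \<noteq> 0" "\<beta> \<noteq> 0" "\<gamma> \<noteq> 0"
  defines "r \<equiv> \<alpha> * \<beta> * \<gamma>\<^sup>2"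
  shows "(N * q - 1 / (N * q)) * (q\<^sup>2 / r\<^sup>2 * x - u) =
    (N * q / r - r / (N * q)) / \<alpha>\<^sup>2 * (\<alpha> * \<beta> / \<gamma>\<^sup>2) * (q\<^sup>2 / r\<^sup>2 * \<gamma> ^ 4 * x - u)
    + (\<alpha> - 1 / \<alpha>) * (N * q / r * \<beta> / \<gamma>\<^sup>2) * (q\<^sup>2 / r\<^sup>2 * \<gamma> ^ 4 * x - u)
    + (\<beta> - 1 / \<beta>) / \<alpha>\<^sup>2 * (r / (N * q) * \<alpha> / \<gamma>\<^sup>2) * (q\<^sup>2 / r\<^sup>2 * x - u)
    + q ^ 3 / \<gamma> ^ 6 * r / (N * q) / \<beta> * (\<gamma> ^ 4 - 1) / q * (x / \<alpha> ^ 3 - u / \<alpha>)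
    - (N - 1 / N) * (q / \<gamma> ^ 4) * (\<gamma> ^ 4 - 1) * u"
  unfolding r_def using nz
  by (simp add: divide_simps) (simp add: algebra_simps eval_nat_numeral)

lemma scalar_odd_even:
  fixes q N \<alpha> \<beta> \<gamma> x u :: "'a::field"
  assumes nz: "q \<noteq> 0" "N \<noteq> 0" "\<alpha> \<noteq> 0" "\<beta> \<noteq> 0" "\<gamma> \<noteq> 0"
  defines "r \<equiv> \<alpha> * \<beta> * \<gamma>\<^sup>2"
  shows "(N * q - 1 / (N * q)) * (1 / r\<^sup>2 * \<gamma> ^ 4 * x - u) =
    (N * q / r - r / (N * q)) / \<alpha>\<^sup>2 * (\<alpha> * \<beta> * \<gamma>\<^sup>2) * (1 / r\<^sup>2 * \<gamma> ^ 4 * x - u)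
    + (\<alpha> - 1 / \<alpha>) * (N * q / r * \<beta> * \<gamma>\<^sup>2) * (1 / r\<^sup>2 * \<gamma> ^ 4 * x - u)
    + (\<beta> - 1 / \<beta>) / \<alpha>\<^sup>2 * (r / (N * q) * \<alpha> * \<gamma>\<^sup>2) * (1 / r\<^sup>2 * x - u)
    + q / \<gamma>\<^sup>2 * r / (N * q) / \<beta> * (\<gamma> ^ 4 - 1) / q * (x / \<alpha> ^ 3 - u / \<alpha>)"
  unfolding r_def using nz
  by (simp add: divide_simps) (simp add: algebra_simps eval_nat_numeral)

lemma scalar_odd_odd:
  fixes q N \<alpha> \<beta> \<gamma> x u :: "'a::field"
  assumes nz: "q \<noteq> 0" "N \<noteq> 0" "\<alpha> \<noteq> 0" "\<beta> \<noteq> 0" "\<gamma> \<noteq> 0"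
  defines "r \<equiv> \<alpha> * \<beta> * \<gamma>\<^sup>2"
  shows "(N * q - 1 / (N * q)) * (q\<^sup>2 / r\<^sup>2 * \<gamma> ^ 4 * x - u) =
    (N * q / r - r / (N * q)) / \<alpha>\<^sup>2 * (\<alpha> * \<beta> * \<gamma>\<^sup>2) * (q\<^sup>2 / r\<^sup>2 * x - u)
    + (N * q\<^sup>2 / r - r / (N * q\<^sup>2)) / \<alpha>\<^sup>2 * (q / \<gamma>\<^sup>2 / (\<alpha> * \<beta>)) * (\<gamma> ^ 4 - 1) * x
    + (\<alpha> - 1 / \<alpha>) * (N * q / r * \<beta> * \<gamma>\<^sup>2) * (q\<^sup>2 / r\<^sup>2 * \<gamma> ^ 4 * x - u)
    + (\<beta> - 1 / \<beta>) / \<alpha>\<^sup>2 * (r / (N * q) * \<alpha> * \<gamma>\<^sup>2) * (q\<^sup>2 / r\<^sup>2 * x - u)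
    + q / \<gamma>\<^sup>2 * r / (N * q) / \<beta> * (\<gamma> ^ 4 - 1) / q * (x / \<alpha> ^ 3 - u / \<alpha>)"
  unfolding r_def using nz
  by (simp add: divide_simps) (simp add: algebra_simps eval_nat_numeral)

section \<open>The recurrence for the Cartan parts\<close>

definition hnum :: "int \<Rightarrow> nat \<Rightarrow> Qq poly" where
  "hnum A c = (\<Prod>i<c. [:- 1, 0, q powi (4 * (A + int i)):])"

definition hden :: "nat \<Rightarrow> Qq" where
  "hden c = (\<Prod>i<c. q ^ (4 * Suc i) - 1)"

definition hpoly :: "int \<Rightarrow> nat \<Rightarrow> Qq poly" where
  "hpoly A c = smult (1 / hden c) (hnum A c)"

lemma hpoly_0 [simp]: "hpoly A 0 = 1"
  by (simp add: hpoly_def hnum_def hden_def)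

lemma hpoly_Suc_high:
  "hpoly A (Suc c) = smult (1 / (q ^ (4 * Suc c) - 1)) ([:- 1, 0, q powi (4 * (A + int c)):]
      * hpoly A c)"
  by (simp add: hpoly_def hnum_def hden_def mult.commute)

text \<open>Splitting off the first factor instead of the last shifts the parameter. Brackets of
  length c + 1 with parameters A and A + 1 thus share the factor
  \<open>hpoly (A + 1) c\<close>.\<close>

lemma hpoly_Suc_low:
  "hpoly A (Suc c) = smult (1 / (q ^ (4 * Suc c) - 1)) ([:- 1, 0, q powi (4 * A):]
      * hpoly (A + 1) c)"
proof -
  have "hnum A (Suc c) = [:- 1, 0, q powi (4 * A):] * hnum (A + 1) c"
    unfolding hnum_def by (subst prod.lessThan_Suc_shift) (simp add: algebra_simps)
  then show ?thesis by (simp add: hpoly_def hden_def mult.commute)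
qed

text \<open>Rescaling the variable by q^(-2) multiplies its square by q^(-4), exactly one step of
  the bracket parameter.\<close>

lemma pcompose_hpoly: "pcompose (hpoly A c) [:0, q powi (- 2):] = hpoly (A - 1) c"
proof (induction c)
  case (Suc c)
  have "q powi (- 2) * (q powi (- 2) * q powi (4 * (A + int c))) = q powi (4 * (A - 1 + int c))"
    using q_nonzero by (simp flip: power_int_add add: algebra_simps)
  then have "pcompose [:- 1, 0, q powi (4 * (A + int c)):] [:0, q powi (- 2):]
      = [:- 1, 0, q powi (4 * (A - 1 + int c)):]"
    by (simp add: pcompose_pCons mult_ac)
  then show ?case
    by (simp only: hpoly_Suc_high pcompose_smult pcompose_mult Suc)
qed (simp add: pcompose_1)

lemma hbinom_eq: "hbinom A c = Kinv_poly (hpoly A c)"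
proof (induction c)
  case (Suc c)
  have "Kinv_poly [:- 1, 0, x:] = x \<cdot> Kpow (- 2) - 1" for x
    by (simp add: Kinv_poly_pCons Kpow_def scaleq_one scaleq_minus_left mult_scaleq_right
        power2_eq_square)
  moreover have "4 * A + 4 * int (Suc c) - 4 = 4 * (A + int c)" by simp
  ultimately have "hbinom A (Suc c)
      = hbinom A c * Kinv_poly
          (smult (1 / (q ^ (4 * Suc c) - 1)) [:- 1, 0, q powi (4 * (A + int c)):])"
    unfolding hbinom_def by (simp only: Kinv_poly_smult upt_Suc_append map_append
        prod_list.append) simp
  then have "hbinom A (Suc c) = Kinv_poly
      (hpoly A c * smult (1 / (q ^ (4 * Suc c) - 1)) [:- 1, 0, q powi (4 * (A + int c)):])"
    by (simp only: Suc Kinv_poly_mult)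
  then show ?case
    by (simp only: hpoly_Suc_high mult_smult_right mult.commute)
qed (simp add: hbinom_def)

text \<open>The exponent of q in the theorem, with r eliminated by r = a + b + 2c. The first two
  summands are the binomial coefficient of 2c or 2c + 1 over 2 according to the parity of n. Integer
  arguments avoid truncation when a, b or c is lowered.\<close>

definition q_exponent :: "nat \<Rightarrow> int \<Rightarrow> int \<Rightarrow> int \<Rightarrow> int" where
  "q_exponent n a b c = c * (2 * c - 1) + 2 * c * int (n mod 2)
      + (a + b) * (a + b + 2 * c - int n) - a * b"

definition h_param :: "nat \<Rightarrow> int \<Rightarrow> int" where
  "h_param n r = - ((r - (if even n then 2 else 1)) div 2)"

text \<open>The factor between \<open>Echeck\<^sup>(\<^sup>a\<^sup>)\<close> and \<open>F\<^sup>(\<^sup>b\<^sup>)\<close> in the summand of the theorem with \<open>r = a + b + 2c\<close>, as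
  a polynomial in \<open>K\<^sup>-\<^sup>1\<close>.\<close>

definition cartan_part :: "Qq \<Rightarrow> nat \<Rightarrow> nat \<Rightarrow> nat \<Rightarrow> nat \<Rightarrow> Qq poly" where
  "cartan_part \<sigma> n a b c = smult (q powi q_exponent n (int a) (int b) (int c) * (q * \<sigma>) ^ c)
     (monom 1 (n - (a + b + 2 * c)) * hpoly (h_param n (int (a + b + 2 * c))) c)"

lemma pcompose_monom: "pcompose (monom 1 k) [:0, c:] = monom (c ^ k) k"
  for c :: "'a::comm_ring_1"
  by (induction k) (simp_all add: monom_Suc pcompose_pCons smult_monom monom_0 mult.commute)

text \<open>This is \<open>right_factor_recurrence\<close> read off at a fixed (a, b, c + 1). The
  first two terms come from multiplication by \<open>Kinv\<close>, the third from
  \<open>Echeck\<close>, the fourth from \<open>F\<close> reaching \<open>F ^ b\<close>, the fifth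
  from the commutator of \<open>F\<close> with \<open>Echeck\<close>, and the last from the lower
  term of \<open>B_Bdiv0\<close>.\<close>

lemma cartan_part_recurrence_Suc:
  fixes \<sigma> :: Qq and n a b c :: nat
  defines "r \<equiv> a + b + 2 * Suc c"
  assumes r: "r \<le> Suc n"
  shows "smult (qint (int n + 1)) (cartan_part \<sigma> (Suc n) a b (Suc c)) =
    smult (qint (int n + 1 - int r) * q powi (- 2 * int a)) ([:0, 1:] * cartan_part \<sigma> n a b (Suc c))
    + (if even (n + r) then smult (q * \<sigma> * qint (int n + 2 - int r) * q powi (- 2 * int a))
        ([:0, 1:] * cartan_part \<sigma> n a b c) else 0)
    + smult (qint (int a)) (cartan_part \<sigma> n (a - 1) b (Suc c))
    + smult (q powi (- 2 * int a) * qint (int b))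
        (pcompose (cartan_part \<sigma> n a (b - 1) (Suc c)) [:0, q powi (- 2):])
    + smult (\<sigma> / (q - 1 / q)) ([:- (q powi (- int a)), 0, q powi (- 3 * int a):]
        * cartan_part \<sigma> n (Suc a) b c)
    - (if even n then smult (q * \<sigma> * qint (int n)) (cartan_part \<sigma> (n - 1) a b c) else 0)"
proof -
  define d where "d = q - 1 / q"
  define N \<alpha> \<beta> \<gamma> \<rho> where "N = q ^ n" and "\<alpha> = q ^ a" and "\<beta> = q ^ b" and "\<gamma> = q ^ Suc c"
    and "\<rho> = \<alpha> * \<beta> * \<gamma>\<^sup>2"
  define A where "A = h_param n (int r - 1) - 1"
  define w where "w = q powi (4 * A)"
  define M where "M = monom (1 :: Qq) (Suc n - r)"
  define H where "H = hpoly (A + 1) c"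
  define D where "D = \<gamma> ^ 4 - 1"
  define p where "p = int (n mod 2)"
  define e where "e = q_exponent (Suc n) (int a) (int b) (int (Suc c))"
  \<comment> \<open>\<open>g\<close> is the change of the binomial part of the exponent from n + 1
    to n at fixed c + 1. \<open>h\<close> also includes lowering c + 1 to c. With the parity kept as
    the number \<open>p\<close>, both parities share one computation.\<close>
  define g where "g = q powi (2 * int (Suc c) * (2 * p - 1))"
  define h where "h = q powi (3 - 2 * p) / \<gamma> ^ 4 * g"
  define \<kappa> where "\<kappa> = q powi e * (q * \<sigma>) ^ Suc c / (D * d)"
  \<comment> \<open>Every bracket below is \<open>H\<close> times one of the linear factors \<open>lo\<close> and \<open>hi\<close> in the square of the
    variable, because its parameter is \<open>A\<close> or \<open>A + 1\<close>.\<close>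
  define lo hi where "lo = [:- 1, 0, w:]" and "hi = [:- 1, 0, w * \<gamma> ^ 4:]"
  have "\<gamma> ^ 4 \<noteq> 1"
    unfolding \<gamma>_def power_mult[symmetric] by (rule q_power_neq_1) simp
  then have nz: "q \<noteq> 0" "d \<noteq> 0" "N \<noteq> 0" "\<alpha> \<noteq> 0" "\<beta> \<noteq> 0" "\<gamma> \<noteq> 0" "\<rho> \<noteq> 0" "D \<noteq> 0" "g \<noteq> 0"
    using q_nonzero q_diff_nonzero
    by (auto simp: d_def N_def \<alpha>_def \<beta>_def \<gamma>_def \<rho>_def D_def g_def simp del: power_Suc)
  have pow: "q powi int n = N" "q powi int a = \<alpha>" "q powi int b = \<beta>" "q powi int (Suc c) = \<gamma>"
    "q powi int r = \<rho>"
    by (simp_all only: N_def \<alpha>_def \<beta>_def \<gamma>_def \<rho>_def power_int_of_nat r_def power_add power_mult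
        power2_eq_square mult_2)
  have hp: "hpoly A (Suc c) = smult (1 / D) (lo * H)" "hpoly (A + 1) (Suc c)
      = smult (1 / D) (hi * H)"
  proof -
    show "hpoly A (Suc c) = smult (1 / D) (lo * H)"
      unfolding lo_def w_def H_def D_def \<gamma>_def
      by (subst hpoly_Suc_low) (simp only: power_mult[symmetric] mult.commute)
    have "q powi (4 * (A + 1 + int c)) = w * \<gamma> ^ 4"
      by (simp add: w_def \<gamma>_def q_powi_simps algebra_simps power_mult_distrib nz(1) flip:
          power_mult)
    then show "hpoly (A + 1) (Suc c) = smult (1 / D) (hi * H)"
      unfolding hi_def H_def D_def \<gamma>_def
      by (subst hpoly_Suc_high) (simp only: power_mult[symmetric] mult.commute)
  qed
  have par: "h_param (Suc n) (int r) = (if even n then A else A + 1)"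
    "h_param n (int r) = (if even (n + r) then A else A + 1)"
    "h_param n (int r - 1) = A + 1"
    "even (n + r) \<Longrightarrow> h_param n (int r - 2) = A + 1"
    "even n \<Longrightarrow> h_param (n - 1) (int r - 2) = A + 1"
    using r by (auto simp: A_def h_param_def r_def; presburger)+
  \<comment> \<open>Once both parities are known the floor in \<open>A\<close> disappears: 4A = k -
    2r with k equal to 0, 2 or 4.\<close>
  have w: "w = (if odd n \<and> even r then 1 else if even n \<and> even r then q ^ 4 else q\<^sup>2) / \<rho>\<^sup>2"
  proof -
    have w_eq: "w = q powi k / \<rho>\<^sup>2" if "4 * A = k - 2 * int r" for k
      using that by (simp add: w_def q_powi_simps pow(5)[unfolded power_int_of_nat]
          power_int_of_nat)
    have "4 * A = (if odd n \<and> even r then 0 else if even n \<and> even r then 4 else 2) - 2 * int r"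
      unfolding A_def h_param_def by auto presburger+
    from w_eq[OF this] show ?thesis by simp
  qed
  define L0 L1 where "L0 = (if even n then lo else hi)" and "L1 = (if even (n + r) then lo else hi)"
  have Q: "qint (int n + 1) = (N * q - 1 / (N * q)) / d"
    "qint (int n + 1 - int r) = (N * q / \<rho> - \<rho> / (N * q)) / d"
    "qint (int n + 2 - int r) = (N * q\<^sup>2 / \<rho> - \<rho> / (N * q\<^sup>2)) / d"
    "qint (int a) = (\<alpha> - 1 / \<alpha>) / d" "qint (int b) = (\<beta> - 1 / \<beta>) / d"
    "qint (int n) = (N - 1 / N) / d"
    by (simp_all only: qint_eq d_def q_powi_simps pow) (simp_all add: mult.commute power2_eq_square)
  have pa: "q powi (- 2 * int a) = 1 / \<alpha>\<^sup>2"
    by (simp only: q_powi_simps pow minus_mult_left[symmetric])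
  have p': "int (Suc n mod 2) = 1 - p"
    unfolding p_def by presburger
  have m: "a + b + 2 * Suc c = r" "int (a + b + 2 * Suc c) = int r"
    by (simp_all add: r_def)
  \<comment> \<open>\<open>E0\<close> to \<open>E6\<close> express all seven Cartan parts by
    \<open>M * H\<close>, a scalar and at most a factor in the squared variable; \<open>T0\<close>
    to \<open>T6\<close> then absorb the quantum integers and expose the common scalar
    \<open>\<kappa>\<close>.\<close>
  have E0: "cartan_part \<sigma> (Suc n) a b (Suc c) = smult (\<kappa> * d) (L0 * (M * H))"
    using nz unfolding cartan_part_def m e_def[symmetric] par \<kappa>_def L0_def
    by (simp add: hp M_def[symmetric] mult_ac)
  have E1: "[:0, 1:] * cartan_part \<sigma> n a b (Suc c)
      = smult (\<kappa> * d * (\<alpha> * \<beta> * g)) (L1 * (M * H))" if "r \<le> n"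
  proof -
    have "q_exponent n (int a) (int b) (int (Suc c)) = e
        + (int a + int b + 2 * int (Suc c) * (2 * p - 1))"
      unfolding q_exponent_def e_def p' p_def[symmetric] by (simp add: algebra_simps)
    then have c: "q powi q_exponent n (int a) (int b) (int (Suc c)) = q powi e * (\<alpha> * \<beta> * g)"
      by (simp only: q_powi_simps(1) pow g_def)
    have "Suc n - r = Suc (n - r)" using that by simp
    then have "M = [:0, 1:] * monom 1 (n - r)"
      by (simp add: M_def monom_Suc)
    then show ?thesis
      using nz unfolding cartan_part_def m c par \<kappa>_def L1_def by (simp add: hp mult_ac)
  qed
  have E2: "smult (q * \<sigma>) ([:0, 1:] * cartan_part \<sigma> n a b c)
      = smult (\<kappa> * d * (h / (\<alpha> * \<beta>)) * D) ([:0, 0, 1:] * (M * H))" if "even (n + r)"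
  proof -
    have "q_exponent n (int a) (int b) (int c)
        = e + (3 - 2 * p - 4 * int (Suc c) + 2 * int (Suc c) * (2 * p - 1) - (int a + int b))"
      unfolding q_exponent_def e_def p' p_def[symmetric] by (simp add: algebra_simps)
    then have c: "q powi q_exponent n (int a) (int b) (int c) = q powi e * (h / (\<alpha> * \<beta>))"
      by (simp only: q_powi_simps(1,2,4)[of _ "int (Suc c)"] q_powi_simps(1,2) pow g_def h_def)
    \<comment> \<open>The monomial has one power more than \<open>M\<close>, and the outer variable
      adds another, which gives the square. The shorter bracket lacks one denominator, hence the
      factor \<open>D\<close>.\<close>
    have "n - (a + b + 2 * c) = Suc (Suc n - r)" "int (a + b + 2 * c) = int r - 2"
      using r by (simp_all add: r_def)
    then show ?thesis
      using nz that unfolding cartan_part_def c \<kappa>_def H_def M_def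
      by (simp add: par monom_Suc mult_ac)
  qed
  have E3: "cartan_part \<sigma> n (a - 1) b (Suc c)
      = smult (\<kappa> * d * (N * q / \<rho> * \<beta> * g)) (hi * (M * H))" if "a > 0"
  proof -
    have a: "int (a - 1) = int a - 1" using that by simp
    have "q_exponent n (int (a - 1)) (int b) (int (Suc c))
        = e + (int n + 1 - int r + int b + 2 * int (Suc c) * (2 * p - 1))"
      unfolding q_exponent_def e_def p' p_def[symmetric] a r_def by (simp add: algebra_simps)
    then have c: "q powi q_exponent n (int (a - 1)) (int b) (int (Suc c))
        = q powi e * (N * q / \<rho> * \<beta> * g)"
      by (simp only: q_powi_simps(1,2) pow g_def power_int_1_right)
    have 1: "n - (a - 1 + b + 2 * Suc c) = Suc n - r" "int (a - 1 + b + 2 * Suc c) = int r - 1"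
      using that r by (simp_all add: r_def)
    show ?thesis
      using nz unfolding cartan_part_def c 1 par \<kappa>_def by (simp add: hp M_def[symmetric] mult_ac)
  qed
  have E4: "pcompose (cartan_part \<sigma> n a (b - 1) (Suc c)) [:0, q powi (- 2):]
      = smult (\<kappa> * d * (\<rho> / (N * q) * \<alpha> * g)) (lo * (M * H))" if "b > 0"
  proof -
    have b: "int (b - 1) = int b - 1" using that by simp
    have "q_exponent n (int a) (int (b - 1)) (int (Suc c))
        = e + (int n + 1 - int r + int a + 2 * int (Suc c) * (2 * p - 1))"
      unfolding q_exponent_def e_def p' p_def[symmetric] b r_def by (simp add: algebra_simps)
    then have c: "q powi q_exponent n (int a) (int (b - 1)) (int (Suc c))
        = q powi e * (N * q / \<rho> * \<alpha> * g)"
      by (simp only: q_powi_simps(1,2) pow g_def power_int_1_right)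
    have 1: "n - (a + (b - 1) + 2 * Suc c) = Suc n - r" "int (a + (b - 1) + 2 * Suc c) = int r - 1"
      using that r by (simp_all add: r_def)
    \<comment> \<open>Rescaling the variable multiplies \<open>M\<close> by a power of q, which
      inverts the factor \<open>N * q / \<rho>\<close>, and lowers the parameter A + 1 to A, so that
      \<open>lo\<close> appears instead of \<open>hi\<close>.\<close>
    have "int (Suc n - r) = int n + 1 - int r" using r by simp
    then have "(q powi (- 2)) ^ (Suc n - r) = q powi (- 2 * (int n + 1 - int r))"
      by (simp only: power_int_mult power_int_of_nat[symmetric])
    also have "\<dots> = (\<rho> / (N * q))\<^sup>2"
      by (simp only: q_powi_simps pow minus_mult_left[symmetric] power_int_1_right)
          (simp add: power_divide)
    finally have 2: "pcompose (monom 1 (Suc n - r)) [:0, q powi (- 2):] = smult ((\<rho> / (N * q))\<^sup>2) M"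
      by (simp only: pcompose_monom) (simp add: M_def smult_monom)
    have 3: "pcompose (hpoly (A + 1) (Suc c)) [:0, q powi (- 2):] = smult (1 / D) (lo * H)"
      by (simp only: pcompose_hpoly add_diff_cancel hp(1))
    show ?thesis
      using nz unfolding cartan_part_def c 1 par \<kappa>_def pcompose_smult pcompose_mult 2 3
      by (simp add: mult_ac power2_eq_square)
  qed
  have E5: "smult \<sigma> (cartan_part \<sigma> n (Suc a) b c)
      = smult (\<kappa> * d * (h * \<rho> / (N * q) / \<beta> * D / q)) (M * H)"
  proof -
    have "q_exponent n (int (Suc a)) (int b) (int c)
        = e + (3 - 2 * p - 4 * int (Suc c) + 2 * int (Suc c) * (2 * p - 1) + int r - (int n + 1)
            - int b)"
      unfolding q_exponent_def e_def p' p_def[symmetric] r_def by (simp add: algebra_simps)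
    then have c: "q powi q_exponent n (int (Suc a)) (int b) (int c)
        = q powi e * (h * \<rho> / (N * q) / \<beta>)"
      by (simp only: q_powi_simps(1,2,4)[of _ "int (Suc c)"] q_powi_simps(1,2) pow g_def h_def
          power_int_1_right)
    have 1: "n - (Suc a + b + 2 * c) = Suc n - r" "int (Suc a + b + 2 * c) = int r - 1"
      using r by (simp_all add: r_def)
    show ?thesis
      using nz unfolding cartan_part_def c 1 par \<kappa>_def H_def M_def by (simp add: mult_ac)
  qed
  have E6: "smult (q * \<sigma>) (cartan_part \<sigma> (n - 1) a b c) = smult (\<kappa> * d * (q / \<gamma> ^ 4) * D) (M * H)"
    if "even n"
  proof -
    have n: "n \<ge> 1" using r by (cases n) (auto simp: r_def)
    then have "int (n - 1) = int n - 1" "int ((n - 1) mod 2) = 1" "p = 0"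
      using that unfolding p_def by (auto, presburger)
    \<comment> \<open>The indices n + 1 and n - 1 have the same parity, and n + 1 - 2(c + 1) = n - 1
      - 2c, so the difference of exponents does not depend on a and b.\<close>
    then have "q_exponent (n - 1) (int a) (int b) (int c) = e + (1 - 4 * int (Suc c))"
      unfolding q_exponent_def e_def p' by (simp add: algebra_simps)
    then have c: "q powi q_exponent (n - 1) (int a) (int b) (int c) = q powi e * (q / \<gamma> ^ 4)"
      by (simp only: q_powi_simps(1,2,4) pow power_int_1_right)
    have 1: "n - 1 - (a + b + 2 * c) = Suc n - r" "int (a + b + 2 * c) = int r - 2"
      using r n by (simp_all add: r_def)
    show ?thesis
      using nz unfolding cartan_part_def c 1 par(5)[OF that] \<kappa>_def H_def M_def
          by (simp add: mult_ac)
  qed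
  have T0: "smult (qint (int n + 1)) (cartan_part \<sigma> (Suc n) a b (Suc c))
      = smult \<kappa> (smult (N * q - 1 / (N * q)) L0 * (M * H))"
    using nz(2) by (simp add: E0 Q mult_ac)
  have T1: "smult (qint (int n + 1 - int r) * q powi (- 2 * int a))
      ([:0, 1:] * cartan_part \<sigma> n a b (Suc c))
      = smult \<kappa> (smult ((N * q / \<rho> - \<rho> / (N * q)) / \<alpha>\<^sup>2 * (\<alpha> * \<beta> * g)) L1 * (M * H))"
  proof (cases "r \<le> n")
    case True
    then show ?thesis using nz(2) by (simp only: E1 Q pa) (simp add: mult_ac)
  next
    case False \<comment> \<open>the subtraction \<open>n - r\<close> truncates, but the coefficient vanishes\<close>
    then have "int n + 1 - int r = 0" using r by simp
    moreover from this have "N * q / \<rho> - \<rho> / (N * q) = 0"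
      using Q(2) nz(2) by simp
    ultimately show ?thesis by simp
  qed
  have T2: "smult (q * \<sigma> * qint (int n + 2 - int r) * q powi (- 2 * int a))
      ([:0, 1:] * cartan_part \<sigma> n a b c)
      = smult \<kappa> (smult ((N * q\<^sup>2 / \<rho> - \<rho> / (N * q\<^sup>2)) / \<alpha>\<^sup>2 * (h / (\<alpha> * \<beta>)) * D) [:0, 0, 1:]
          * (M * H))"
    if "even (n + r)"
    using E2[OF that, THEN
        arg_cong[where f = "smult (qint (int n + 2 - int r) * q powi (- 2 * int a))"]] nz(2)
    by (simp only: Q pa smult_smult) (simp add: mult_ac)
  have T3: "smult (qint (int a)) (cartan_part \<sigma> n (a - 1) b (Suc c))
      = smult \<kappa> (smult ((\<alpha> - 1 / \<alpha>) * (N * q / \<rho> * \<beta> * g)) hi * (M * H))"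
  \<comment> \<open>For a = 0 the subtraction \<open>a - 1\<close> truncates, but the coefficient
    \<open>\<alpha> - 1 / \<alpha>\<close> is zero. The case b = 0 in \<open>T4\<close> is
    analogous.\<close>
  proof (cases "a > 0")
    case True
    then show ?thesis using nz(2) by (simp only: E3 Q) (simp add: mult_ac)
  qed (simp add: \<alpha>_def)
  have T4: "smult (q powi (- 2 * int a) * qint (int b))
      (pcompose (cartan_part \<sigma> n a (b - 1) (Suc c)) [:0, q powi (- 2):])
      = smult \<kappa> (smult ((\<beta> - 1 / \<beta>) / \<alpha>\<^sup>2 * (\<rho> / (N * q) * \<alpha> * g)) lo * (M * H))"
  proof (cases "b > 0")
    case True
    then show ?thesis using nz(2) by (simp only: E4 Q pa) (simp add: mult_ac)
  qed (simp add: \<beta>_def)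
  have T5: "smult (\<sigma> / (q - 1 / q)) ([:- (q powi (- int a)), 0, q powi (- 3 * int a):]
      * cartan_part \<sigma> n (Suc a) b c)
      = smult \<kappa> (smult (h * \<rho> / (N * q) / \<beta> * D / q) [:- 1 / \<alpha>, 0, 1 / \<alpha> ^ 3:] * (M * H))"
  proof -
    have pa': "q powi (- int a) = 1 / \<alpha>" "q powi (- 3 * int a) = 1 / \<alpha> ^ 3"
      by (simp_all only: q_powi_simps pow minus_mult_left[symmetric])
    \<comment> \<open>Stated for arbitrary \<open>Y\<close> so that simplification does not expand
      the explicit quadratic; the scalar \<sigma> supplies the power of \<open>q * \<sigma>\<close>
      missing from the shorter Cartan part.\<close>
    have "smult (\<sigma> / d) (Y * cartan_part \<sigma> n (Suc a) b c)
        = smult \<kappa> (smult (h * \<rho> / (N * q) / \<beta> * D / q) Y * (M * H))" for Y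
    proof -
      have "smult (\<sigma> / d) (Y * cartan_part \<sigma> n (Suc a) b c)
          = smult (1 / d) (Y * smult \<sigma> (cartan_part \<sigma> n (Suc a) b c))"
        by simp
      then show ?thesis
        unfolding E5 using nz(2) by (simp add: mult_ac)
    qed
    then show ?thesis
      unfolding d_def[symmetric] pa' minus_divide_left .
  qed
  have T6: "smult (q * \<sigma> * qint (int n)) (cartan_part \<sigma> (n - 1) a b c)
      = smult \<kappa> (smult ((N - 1 / N) * (q / \<gamma> ^ 4) * D) 1 * (M * H))"
    if "even n"
    using E6[OF that, THEN arg_cong[where f = "smult (qint (int n))"]] nz(2)
    by (simp only: Q smult_smult) (simp add: mult_ac)
  \<comment> \<open>What remains after removing \<open>\<kappa>\<close> and \<open>M * H\<close>: an
    identity between polynomials of the form u + v X^2.\<close>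
  have "smult (N * q - 1 / (N * q)) L0 =
      smult ((N * q / \<rho> - \<rho> / (N * q)) / \<alpha>\<^sup>2 * (\<alpha> * \<beta> * g)) L1
      + (if even (n + r) then smult ((N * q\<^sup>2 / \<rho> - \<rho> / (N * q\<^sup>2)) / \<alpha>\<^sup>2 * (h / (\<alpha> * \<beta>)) * D)
          [:0, 0, 1:] else 0)
      + smult ((\<alpha> - 1 / \<alpha>) * (N * q / \<rho> * \<beta> * g)) hi
      + smult ((\<beta> - 1 / \<beta>) / \<alpha>\<^sup>2 * (\<rho> / (N * q) * \<alpha> * g)) lo
      + smult (h * \<rho> / (N * q) / \<beta> * D / q) [:- 1 / \<alpha>, 0, 1 / \<alpha> ^ 3:]
      - (if even n then smult ((N - 1 / N) * (q / \<gamma> ^ 4) * D) 1 else 0)"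
    (is "?X0 = ?X1 + ?X2 + ?X3 + ?X4 + ?X5 - ?X6")
  proof -
    have gh: "g = 1 / \<gamma>\<^sup>2" "h = q ^ 3 / \<gamma> ^ 6" if "even n"
    proof -
      have p: "p = 0" "2 * int (Suc c) * (2 * p - 1) = - (2 * int (Suc c))"
        using that by (auto simp: p_def)
      then show g: "g = 1 / \<gamma>\<^sup>2"
        by (simp only: g_def q_powi_simps pow)
      show "h = q ^ 3 / \<gamma> ^ 6"
        by (simp add: h_def p(1) g eval_nat_numeral mult_ac)
    qed
    have gh': "g = \<gamma>\<^sup>2" "h = q / \<gamma>\<^sup>2" if "odd n"
    proof -
      have p: "p = 1" "2 * int (Suc c) * (2 * p - 1) = 2 * int (Suc c)"
        using that by (auto simp: p_def odd_iff_mod_2_eq_one)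
      then show g: "g = \<gamma>\<^sup>2"
        by (simp only: g_def q_powi_simps pow)
      show "h = q / \<gamma>\<^sup>2"
        using nz(6) by (simp add: h_def p(1) g eval_nat_numeral mult_ac)
    qed
    consider "even n" "even r" | "even n" "odd r" | "odd n" "even r" | "odd n" "odd r" by blast
    then show ?thesis
    proof cases
      case 1
      note s = scalar_even_even[OF nz(1,3,4,5,6), folded \<rho>_def]
      \<comment> \<open>Taking (x, u) = (1, 0) gives the coefficient of X^2, and (0, 1) the constant
        coefficient; likewise in the other three cases.\<close>
      show ?thesis using 1 s[of 1 0] s[of 0 1]
        by (simp add: L0_def L1_def lo_def hi_def w gh D_def one_pCons)
    next
      case 2
      note s = scalar_even_odd[OF nz(1,3,4,5,6), folded \<rho>_def]
      show ?thesis using 2 s[of 1 0] s[of 0 1]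
        by (simp add: L0_def L1_def lo_def hi_def w gh D_def one_pCons)
    next
      case 3
      note s = scalar_odd_even[OF nz(1,3,4,5,6), folded \<rho>_def]
      show ?thesis using 3 s[of 1 0] s[of 0 1]
        by (simp add: L0_def L1_def lo_def hi_def w gh' D_def \<rho>_def[symmetric] one_pCons)
    next
      case 4
      note s = scalar_odd_odd[OF nz(1,3,4,5,6), folded \<rho>_def]
      show ?thesis using 4 s[of 1 0] s[of 0 1]
        by (simp add: L0_def L1_def lo_def hi_def w gh' D_def \<rho>_def[symmetric] one_pCons)
    qed
  qed
  then have "smult \<kappa> (?X0 * (M * H)) = smult \<kappa> (?X1 * (M * H)) + smult \<kappa> (?X2 * (M * H))
      + smult \<kappa> (?X3 * (M * H)) + smult \<kappa> (?X4 * (M * H)) + smult \<kappa> (?X5 * (M * H))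
      - smult \<kappa> (?X6 * (M * H))"
    by (simp only: distrib_right left_diff_distrib smult_add_right smult_diff_right)
  moreover have "smult \<kappa> (?X2 * (M * H))
      = (if even (n + r) then smult (q * \<sigma> * qint (int n + 2 - int r) * q powi (- 2 * int a))
      ([:0, 1:] * cartan_part \<sigma> n a b c) else 0)"
    using T2 by simp
  moreover have "smult \<kappa> (?X6 * (M * H))
      = (if even n then smult (q * \<sigma> * qint (int n)) (cartan_part \<sigma> (n - 1) a b c) else 0)"
    using T6 by simp
  ultimately show ?thesis
    by (simp only: T0 T1 T3 T4 T5)
qed

text \<open>For c = 0 the brackets are 1 and no term can come from c - 1, so every term is a scalar
  multiple of one monomial.\<close>

lemma cartan_part_recurrence_0:
  assumes "a + b \<le> Suc n"
  shows "smult (qint (int n + 1)) (cartan_part \<sigma> (Suc n) a b 0) =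
    smult (qint (int n + 1 - int (a + b)) * q powi (- 2 * int a)) ([:0, 1:] * cartan_part \<sigma> n a b 0)
    + smult (qint (int a)) (cartan_part \<sigma> n (a - 1) b 0)
    + smult (q powi (- 2 * int a) * qint (int b))
        (pcompose (cartan_part \<sigma> n a (b - 1) 0) [:0, q powi (- 2):])"
proof -
  define d N \<alpha> \<beta> where "d = q - 1 / q" and "N = q ^ n" and "\<alpha> = q ^ a" and "\<beta> = q ^ b"
  define M where "M = monom (1 :: Qq) (Suc n - (a + b))"
  define e where "e = q_exponent (Suc n) (int a) (int b) 0"
  have nz: "q \<noteq> 0" "d \<noteq> 0" "N \<noteq> 0" "\<alpha> \<noteq> 0" "\<beta> \<noteq> 0"
    using q_nonzero q_diff_nonzero by (auto simp: d_def N_def \<alpha>_def \<beta>_def)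
  have pow: "q powi int n = N" "q powi int a = \<alpha>" "q powi int b = \<beta>" "q powi int (a + b) = \<alpha> * \<beta>"
    by (simp_all only: N_def \<alpha>_def \<beta>_def power_int_of_nat power_add)
  have Q: "qint (int n + 1) = (N * q - 1 / (N * q)) / d"
    "qint (int n + 1 - int (a + b)) = (N * q / (\<alpha> * \<beta>) - \<alpha> * \<beta> / (N * q)) / d"
    "qint (int a) = (\<alpha> - 1 / \<alpha>) / d" "qint (int b) = (\<beta> - 1 / \<beta>) / d"
    by (simp_all only: qint_eq d_def q_powi_simps pow) simp_all
  have pa: "q powi (- 2 * int a) = 1 / \<alpha>\<^sup>2"
    by (simp only: q_powi_simps pow minus_mult_left[symmetric])
  have T0: "smult (qint (int n + 1)) (cartan_part \<sigma> (Suc n) a b 0)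
      = smult (q powi e / d) (smult (N * q - 1 / (N * q)) M)"
    by (simp add: cartan_part_def Q M_def e_def mult_ac)
  have T1: "smult (qint (int n + 1 - int (a + b)) * q powi (- 2 * int a))
      ([:0, 1:] * cartan_part \<sigma> n a b 0)
      = smult (q powi e / d) (smult ((N * q / (\<alpha> * \<beta>) - \<alpha> * \<beta> / (N * q)) / \<alpha>\<^sup>2 * (\<alpha> * \<beta>)) M)"
  proof (cases "a + b \<le> n")
    case True
    have "q_exponent n (int a) (int b) 0 = e + (int a + int b)"
      unfolding q_exponent_def e_def by (simp add: algebra_simps)
    then have c: "q powi q_exponent n (int a) (int b) 0 = q powi e * (\<alpha> * \<beta>)"
      by (simp only: q_powi_simps(1) pow)
    have "M = [:0, 1:] * monom 1 (n - (a + b))"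
      using True by (simp add: M_def monom_Suc Suc_diff_le)
    then show ?thesis unfolding Q pa by (simp add: cartan_part_def c mult_ac)
  next
    case False
    then have "int n + 1 - int (a + b) = 0" using assms by simp
    moreover from this have "N * q / (\<alpha> * \<beta>) - \<alpha> * \<beta> / (N * q) = 0"
      using Q(2) nz(2) by simp
    ultimately show ?thesis by simp
  qed
  have T2: "smult (qint (int a)) (cartan_part \<sigma> n (a - 1) b 0)
      = smult (q powi e / d) (smult ((\<alpha> - 1 / \<alpha>) * (N * q / \<alpha>)) M)"
  proof (cases "a > 0")
    case True
    then have a: "int (a - 1) = int a - 1" by simp
    have "q_exponent n (int (a - 1)) (int b) 0 = e + (int n + 1 - int a)"
      unfolding q_exponent_def e_def a by (simp add: algebra_simps)
    then have c: "q powi q_exponent n (int (a - 1)) (int b) 0 = q powi e * (N * q / \<alpha>)"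
      by (simp only: q_powi_simps(1,2) pow power_int_1_right)
    have 1: "n - (a - 1 + b) = Suc n - (a + b)" using True by simp
    show ?thesis unfolding Q by (simp add: cartan_part_def c[simplified] 1[simplified] M_def
        mult_ac)
  qed (simp add: \<alpha>_def)
  have T3: "smult (q powi (- 2 * int a) * qint (int b))
      (pcompose (cartan_part \<sigma> n a (b - 1) 0) [:0, q powi (- 2):])
      = smult (q powi e / d) (smult ((\<beta> - 1 / \<beta>) * (\<beta> / (N * q))) M)"
  proof (cases "b > 0")
    case True
    then have b: "int (b - 1) = int b - 1" by simp
    have "q_exponent n (int a) (int (b - 1)) 0 = e + (int n + 1 - int b)"
      unfolding q_exponent_def e_def b by (simp add: algebra_simps)
    then have c: "q powi q_exponent n (int a) (int (b - 1)) 0 = q powi e * (N * q / \<beta>)"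
      by (simp only: q_powi_simps(1,2) pow power_int_1_right)
    have 1: "n - (a + (b - 1)) = Suc n - (a + b)" using True by simp
    have "int (Suc n - (a + b)) = int n + 1 - int (a + b)" using assms by simp
    then have "(q powi (- 2)) ^ (Suc n - (a + b)) = q powi (- 2 * (int n + 1 - int (a + b)))"
      by (simp only: power_int_mult power_int_of_nat[symmetric])
    also have "\<dots> = (\<alpha> * \<beta> / (N * q))\<^sup>2"
      by (simp only: q_powi_simps(2-) q_powi_simps(1)[of "int n"] pow minus_mult_left[symmetric]
          power_int_1_right) (simp add: power_divide)
    finally have 2: "pcompose (monom 1 (Suc n - (a + b))) [:0, q powi (- 2):]
        = smult ((\<alpha> * \<beta> / (N * q))\<^sup>2) M"
      by (simp only: pcompose_monom) (simp add: M_def smult_monom)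
    show ?thesis
      using nz unfolding Q pa
          by (simp add: cartan_part_def pcompose_smult c[simplified] 1[simplified] 2[simplified]
          power2_eq_square mult_ac)
  qed (simp add: \<beta>_def)
  \<comment> \<open>The contributions N q / \<alpha>^2 and \<beta>^2 / (N q) cancel between
    neighbouring terms.\<close>
  have "N * q - 1 / (N * q) = (N * q / (\<alpha> * \<beta>) - \<alpha> * \<beta> / (N * q)) / \<alpha>\<^sup>2 * (\<alpha> * \<beta>)
      + (\<alpha> - 1 / \<alpha>) * (N * q / \<alpha>) + (\<beta> - 1 / \<beta>) * (\<beta> / (N * q))"
    using nz by (simp add: divide_simps) (simp add: algebra_simps eval_nat_numeral)
  then show ?thesis
    by (simp only: T0 T1 T2 T3 smult_add_left smult_add_right)
qed

lemma cartan_part_recurrence: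
  fixes \<sigma> :: Qq and n a b c :: nat
  assumes "a + b + 2 * c = r" "r \<le> Suc n"
  shows "smult (qint (int n + 1)) (cartan_part \<sigma> (Suc n) a b c) =
    smult (qint (int n + 1 - int r) * q powi (- 2 * int a)) ([:0, 1:] * cartan_part \<sigma> n a b c)
    + (if c > 0 \<and> even (n + r)
        then smult (q * \<sigma> * qint (int n + 2 - int r) * q powi (- 2 * int a))
        ([:0, 1:] * cartan_part \<sigma> n a b (c - 1)) else 0)
    + smult (qint (int a)) (cartan_part \<sigma> n (a - 1) b c)
    + smult (q powi (- 2 * int a) * qint (int b))
        (pcompose (cartan_part \<sigma> n a (b - 1) c) [:0, q powi (- 2):])
    + (if c > 0 then smult (\<sigma> / (q - 1 / q)) ([:- (q powi (- int a)), 0, q powi (- 3 * int a):]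
        * cartan_part \<sigma> n (Suc a) b (c - 1)) else 0)
    - (if c > 0 \<and> even n then smult (q * \<sigma> * qint (int n)) (cartan_part \<sigma> (n - 1) a b (c - 1))
        else 0)"
proof (cases c)
  case 0
  then have r: "r = a + b" using assms(1) by simp
  show ?thesis using cartan_part_recurrence_0[of a b n \<sigma>] assms(2) unfolding r 0 by simp
next
  case (Suc k)
  show ?thesis using cartan_part_recurrence_Suc[of a b k n \<sigma>] assms unfolding Suc
      by (simp only: diff_Suc_1 zero_less_Suc simp_thms if_True)
qed

section \<open>The right-hand tensor factors\<close>

lemma divpow_Suc: "x * divpow x a = qint (int a + 1) \<cdot> divpow x (Suc a)"
  using qint_nonzero[of "Suc a"]
  by (simp add: divpow_def qfact_Suc mult_scaleq_right scaleq_scaleq add.commute)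

text \<open>Monomials in Poincare-Birkhoff-Witt order, with the whole Cartan part kept as one
  polynomial. Left multiplication by \<open>Kinv\<close>, \<open>Echeck\<close> and \<open>F\<close>
  yields sums of such monomials again.\<close>

definition pbw :: "Qq \<Rightarrow> nat \<Rightarrow> Qq poly \<Rightarrow> nat \<Rightarrow> U" where
  "pbw \<sigma> a p b = divpow (Echeck \<sigma>) a * Kinv_poly p * divpow F b"

lemma pbw_0 [simp]: "pbw \<sigma> a 0 b = 0"
  by (simp add: pbw_def)

lemma pbw_add: "pbw \<sigma> a (p + r) b = pbw \<sigma> a p b + pbw \<sigma> a r b"
  by (simp add: pbw_def Kinv_poly_add distrib_left distrib_right)

lemma pbw_smult: "pbw \<sigma> a (smult s p) b = s \<cdot> pbw \<sigma> a p b"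
  by (simp add: pbw_def Kinv_poly_smult mult_scaleq_left mult_scaleq_right)

lemma pbw_diff: "pbw \<sigma> a (p - r) b = pbw \<sigma> a p b - pbw \<sigma> a r b"
  using pbw_add[of \<sigma> a "p - r" r b] by (simp add: eq_diff_eq)

lemma Echeck_pbw: "Echeck \<sigma> * pbw \<sigma> a p b = pbw \<sigma> (Suc a) (smult (qint (int a + 1)) p) b"
  unfolding pbw_smult by (simp add: pbw_def divpow_Suc mult_scaleq_left flip: mult.assoc)

lemma Kinv_pbw: "Kinv * pbw \<sigma> a p b = pbw \<sigma> a (smult (q powi (- 2 * int a)) ([:0, 1:] * p)) b"
proof -
  have "Kinv * pbw \<sigma> a p b = (Kinv * divpow (Echeck \<sigma>) a) * Kinv_poly p * divpow F b"
    by (simp only: pbw_def mult.assoc)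
  also have "Kinv * divpow (Echeck \<sigma>) a = q powi (- 2 * int a) \<cdot> (divpow (Echeck \<sigma>) a * Kinv)"
    by (simp only: divpow_def mult_scaleq_left mult_scaleq_right Kinv_Echeck_power scaleq_scaleq
        mult.commute)
  finally show ?thesis
    by (simp only: pbw_smult) (simp only: pbw_def Kinv_poly_mult Kinv_poly_X mult_scaleq_left
        mult.assoc)
qed

text \<open>Passing to divided powers cancels the quantum integer [a] in the Cartan term of
  \<open>F_Echeck_power\<close>. For a = 0 there is no commutator.\<close>

lemma F_divpow_Echeck:
  "F * divpow (Echeck \<sigma>) a = q powi (- 2 * int a) \<cdot> (divpow (Echeck \<sigma>) a * F)
     + (if a = 0 then 0 else divpow (Echeck \<sigma>) (a - 1) * Kinv_poly (smult (\<sigma> / (q - 1 / q))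
         [:- (q powi (- int (a - 1))), 0, q powi (- 3 * int (a - 1)):]))"
proof (cases a)
  case 0
  then show ?thesis by (simp add: divpow_def scaleq_one)
next
  case (Suc k)
  have nz: "qint (int k + 1) \<noteq> 0" using qint_nonzero[of "Suc k"] by (simp add: add.commute)
  have "F * divpow (Echeck \<sigma>) (Suc k) = (1 / qfact (Suc k)) \<cdot> (F * Echeck \<sigma> ^ Suc k)"
    by (simp only: divpow_def mult_scaleq_right)
  also have "\<dots> = (1 / qfact (Suc k) * q powi (- 2 * (int k + 1))) \<cdot> (Echeck \<sigma> ^ Suc k * F)
     + (1 / qfact (Suc k) * (\<sigma> * qint (int k + 1) / (q - 1 / q))) \<cdot>
         (Echeck \<sigma> ^ k * Kinv_poly [:- (q powi (- int k)), 0, q powi (- 3 * int k):])"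
    by (simp only: F_Echeck_power scaleq_add_right scaleq_scaleq)
  also have "1 / qfact (Suc k) * (\<sigma> * qint (int k + 1) / (q - 1 / q))
      = \<sigma> / (q - 1 / q) * (1 / qfact k)"
    using nz by (simp add: qfact_Suc)
  also have "1 / qfact (Suc k) * q powi (- 2 * (int k + 1))
      = q powi (- 2 * int (Suc k)) * (1 / qfact (Suc k))"
    by (simp add: algebra_simps)
  finally show ?thesis
    unfolding Suc
    by (simp add: divpow_def Kinv_poly_smult mult_scaleq_left mult_scaleq_right scaleq_scaleq
        del: power_Suc smult_pCons)
qed

text \<open>\<open>F\<close> either crosses everything, rescaling p and raising b, or is consumed by
  one \<open>Echeck\<close>, which lowers a and multiplies p by a quadratic.\<close>

lemma F_pbw:
  "F * pbw \<sigma> a p b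
     = pbw \<sigma> a (smult (q powi (- 2 * int a) * qint (int b + 1)) (pcompose p [:0, q powi (- 2):]))
         (Suc b)
     + (if a = 0 then 0 else pbw \<sigma> (a - 1) (smult (\<sigma> / (q - 1 / q))
         ([:- (q powi (- int (a - 1))), 0, q powi (- 3 * int (a - 1)):] * p)) b)"
    (is "_ = _ + (if a = 0 then 0 else pbw \<sigma> _ (smult ?s (?r * p)) b)")
proof -
  have "F * pbw \<sigma> a p b = (F * divpow (Echeck \<sigma>) a) * Kinv_poly p * divpow F b"
    by (simp add: pbw_def mult.assoc)
  also have "\<dots> = q powi (- 2 * int a) \<cdot> (divpow (Echeck \<sigma>) a * (F * Kinv_poly p) * divpow F b)
      + (if a = 0 then 0 else divpow (Echeck \<sigma>) (a - 1) * Kinv_poly (smult ?s ?r) * Kinv_poly p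
          * divpow F b)"
    by (simp only: F_divpow_Echeck distrib_right mult_scaleq_left mult.assoc
        if_distrib[of "\<lambda>x. x * _"] mult_zero_left)
  also have "divpow (Echeck \<sigma>) a * (F * Kinv_poly p) * divpow F b
      = qint (int b + 1) \<cdot> pbw \<sigma> a (pcompose p [:0, q powi (- 2):]) (Suc b)"
    by (simp only: F_Kinv_poly pbw_def mult.assoc divpow_Suc mult_scaleq_right)
  also have "divpow (Echeck \<sigma>) (a - 1) * Kinv_poly (smult ?s ?r) * Kinv_poly p * divpow F b
      = pbw \<sigma> (a - 1) (smult ?s ?r * p) b"
    by (simp only: pbw_def Kinv_poly_mult mult.assoc)
  finally show ?thesis
    by (simp only: pbw_smult mult_smult_left scaleq_scaleq)
qed

section \<open>Reindexing sums over a + b + 2c = r\<close>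

definition triples :: "nat \<Rightarrow> (nat \<times> nat \<times> nat) set" where
  "triples r = {(a, b, c). a + b + 2 * c = r}"

lemma finite_triples [simp]: "finite (triples r)"
  by (rule finite_subset[of _ "{..r} \<times> {..r} \<times> {..r}"]) (auto simp: triples_def)

lemma sum_triples_shift_1:
  assumes "\<And>b c. f 0 b c = 0"
  shows "(\<Sum>(a, b, c)\<in>triples (Suc r). f a b c) = (\<Sum>(a, b, c)\<in>triples r. f (Suc a) b c)"
proof -
  have "(\<Sum>(a, b, c)\<in>triples (Suc r). f a b c)
      = (\<Sum>(a, b, c)\<in>{t\<in>triples (Suc r). fst t > 0}. f a b c)"
    by (rule sum.mono_neutral_right) (auto simp: assms intro!: gr0I)
  also have "\<dots> = (\<Sum>(a, b, c)\<in>triples r. f (Suc a) b c)"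
    by (rule sum.reindex_bij_witness[where i = "\<lambda>(a, b, c). (Suc a, b, c)"
          and j = "\<lambda>(a, b, c). (a - 1, b, c)"]) (auto simp: triples_def)
  finally show ?thesis .
qed

lemma sum_triples_shift_2:
  assumes "\<And>a c. f a 0 c = 0"
  shows "(\<Sum>(a, b, c)\<in>triples (Suc r). f a b c) = (\<Sum>(a, b, c)\<in>triples r. f a (Suc b) c)"
proof -
  have "(\<Sum>(a, b, c)\<in>triples (Suc r). f a b c)
      = (\<Sum>(a, b, c)\<in>{t\<in>triples (Suc r). fst (snd t) > 0}. f a b c)"
    by (rule sum.mono_neutral_right) (auto simp: assms intro!: gr0I)
  also have "\<dots> = (\<Sum>(a, b, c)\<in>triples r. f a (Suc b) c)"
    by (rule sum.reindex_bij_witness[where i = "\<lambda>(a, b, c). (a, Suc b, c)"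
          and j = "\<lambda>(a, b, c). (a, b - 1, c)"]) (auto simp: triples_def)
  finally show ?thesis .
qed

text \<open>Only triples with positive c contribute, and lowering c lowers the total by 2; for r < 2
  there are none.\<close>

lemma sum_triples_shift_3:
  assumes "\<And>a b. f a b 0 = 0"
  shows "(\<Sum>(a, b, c)\<in>triples r. f a b c)
    = (if r \<ge> 2 then \<Sum>(a, b, c)\<in>triples (r - 2). f a b (Suc c) else 0)"
proof -
  have "(\<Sum>(a, b, c)\<in>triples r. f a b c) = (\<Sum>(a, b, c)\<in>{t\<in>triples r. snd (snd t) > 0}. f a b c)"
    by (rule sum.mono_neutral_right) (auto simp: assms intro!: gr0I)
  also have "\<dots> = (if r \<ge> 2 then \<Sum>(a, b, c)\<in>triples (r - 2). f a b (Suc c) else 0)"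
  proof (cases "r \<ge> 2")
    case True
    have "(\<Sum>(a, b, c)\<in>{t\<in>triples r. snd (snd t) > 0}. f a b c)
        = (\<Sum>(a, b, c)\<in>triples (r - 2). f a b (Suc c))"
      by (rule sum.reindex_bij_witness[where i = "\<lambda>(a, b, c). (a, b, Suc c)"
            and j = "\<lambda>(a, b, c). (a, b, c - 1)"]) (use True in \<open>auto simp: triples_def\<close>)
    then show ?thesis using True by simp
  next
    case False
    then have "{t\<in>triples r. snd (snd t) > 0} = {}" by (auto simp: triples_def)
    then show ?thesis using False by (simp only: if_False sum.empty)
  qed
  finally show ?thesis .
qed

text \<open>Fits the commutator term of \<open>F\<close>: it consumes one \<open>Echeck\<close> and
  raises the total by one, so (a + 1, b, c) must become (a, b, c + 1).\<close>

lemma sum_triples_shift_1_3: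
  assumes "\<And>a b. f a b 0 = 0" "\<And>b c. g 0 b c = 0" "\<And>a b c. g (Suc a) b c = f a b (Suc c)"
  shows "(\<Sum>(a, b, c)\<in>triples (Suc r). f a b c) = (\<Sum>(a, b, c)\<in>triples r. g a b c)"
proof -
  have "(\<Sum>(a, b, c)\<in>triples (Suc r). f a b c)
      = (\<Sum>(a, b, c)\<in>{t\<in>triples (Suc r). snd (snd t) > 0}. f a b c)"
    by (rule sum.mono_neutral_right) (auto simp: assms(1) intro!: gr0I)
  also have "\<dots> = (\<Sum>(a, b, c)\<in>{t\<in>triples r. fst t > 0}. g a b c)"
    by (rule sum.reindex_bij_witness[where i = "\<lambda>(a, b, c). (a - 1, b, Suc c)"
          and j = "\<lambda>(a, b, c). (Suc a, b, c - 1)"]) (auto simp: triples_def assms(3))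
  also have "\<dots> = (\<Sum>(a, b, c)\<in>triples r. g a b c)"
    by (rule sum.mono_neutral_left) (auto simp: assms(2) intro!: gr0I)
  finally show ?thesis .
qed

section \<open>The right factors and their recurrence\<close>

definition right_factor :: "Qq \<Rightarrow> nat \<Rightarrow> nat \<Rightarrow> U" where
  "right_factor \<sigma> n r = (\<Sum>(a, b, c)\<in>triples r. pbw \<sigma> a (cartan_part \<sigma> n a b c) b)"

lemma Kinv_right_factor: "Kinv * right_factor \<sigma> n r
   = (\<Sum>(a, b, c)\<in>triples r. pbw \<sigma> a
       (smult (q powi (- 2 * int a)) ([:0, 1:] * cartan_part \<sigma> n a b c)) b)"
  by (simp only: right_factor_def sum_distrib_left prod.case_distrib[of "\<lambda>x. Kinv * x"] Kinv_pbw)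

lemma B_right_factor:
  "B \<sigma> * right_factor \<sigma> n r = (\<Sum>(a, b, c)\<in>triples (Suc r).
      pbw \<sigma> a (smult (qint (int a)) (cartan_part \<sigma> n (a - 1) b c)) b
    + pbw \<sigma> a (smult (q powi (- 2 * int a) * qint (int b))
        (pcompose (cartan_part \<sigma> n a (b - 1) c) [:0, q powi (- 2):])) b
    + pbw \<sigma> a (if c > 0
        then smult (\<sigma> / (q - 1 / q)) ([:- (q powi (- int a)), 0, q powi (- 3 * int a):]
        * cartan_part \<sigma> n (Suc a) b (c - 1)) else 0) b)"
proof -
  \<comment> \<open>\<open>f1\<close>, \<open>f2\<close>, \<open>f3\<close> are indexed by the
    exponents after multiplication. \<open>g3\<close> holds the commutator terms of
    \<open>f3\<close>, indexed by the exponents before it.\<close>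
  define f1 f2 f3 g3 where
    "f1 a b c = pbw \<sigma> a (smult (qint (int a)) (cartan_part \<sigma> n (a - 1) b c)) b"
    and "f2 a b c = pbw \<sigma> a
        (smult (q powi (- 2 * int a) * qint (int b))
        (pcompose (cartan_part \<sigma> n a (b - 1) c) [:0, q powi (- 2):])) b"
    and "f3 a b c = pbw \<sigma> a
        (if c > 0 then smult (\<sigma> / (q - 1 / q)) ([:- (q powi (- int a)), 0, q powi (- 3 * int a):]
        * cartan_part \<sigma> n (Suc a) b (c - 1)) else 0) b"
    and "g3 a b c = (if a = 0 then 0 else pbw \<sigma> (a - 1) (smult (\<sigma> / (q - 1 / q))
         ([:- (q powi (- int (a - 1))), 0, q powi (- 3 * int (a - 1)):] * cartan_part \<sigma> n a b c))
             b)"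
    for a b c
  have "Echeck \<sigma> * pbw \<sigma> a (cartan_part \<sigma> n a b c) b = f1 (Suc a) b c" for a b c
    by (simp add: Echeck_pbw f1_def add.commute)
  then have 1: "Echeck \<sigma> * right_factor \<sigma> n r = (\<Sum>(a, b, c)\<in>triples (Suc r). f1 a b c)"
    by (subst sum_triples_shift_1)
        (simp_all add: f1_def[of 0] right_factor_def sum_distrib_left split_def)
  have "f2 a (Suc b) c = pbw \<sigma> a (smult (q powi (- 2 * int a) * qint (int b + 1))
      (pcompose (cartan_part \<sigma> n a b c) [:0, q powi (- 2):])) (Suc b)" for a b c
    by (simp add: f2_def add.commute)
  then have "F * pbw \<sigma> a (cartan_part \<sigma> n a b c) b = f2 a (Suc b) c + g3 a b c" for a b c
    by (simp only: F_pbw g3_def)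
  then have "F * right_factor \<sigma> n r = (\<Sum>(a, b, c)\<in>triples r. f2 a (Suc b) c)
      + (\<Sum>(a, b, c)\<in>triples r. g3 a b c)"
    by (simp add: right_factor_def sum_distrib_left split_def sum.distrib)
  also have "(\<Sum>(a, b, c)\<in>triples r. f2 a (Suc b) c) = (\<Sum>(a, b, c)\<in>triples (Suc r). f2 a b c)"
    by (rule sum_triples_shift_2[symmetric]) (simp add: f2_def)
  also have "(\<Sum>(a, b, c)\<in>triples r. g3 a b c) = (\<Sum>(a, b, c)\<in>triples (Suc r). f3 a b c)"
    by (rule sum_triples_shift_1_3[symmetric]) (simp_all add: f3_def g3_def)
  finally have "B \<sigma> * right_factor \<sigma> n r
      = (\<Sum>(a, b, c)\<in>triples (Suc r). f1 a b c + f2 a b c + f3 a b c)"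
    by (simp add: B_def distrib_right 1 split_def sum.distrib add_ac)
  then show ?thesis
    by (simp only: f1_def f2_def f3_def)
qed

text \<open>Obtained by summing \<open>cartan_part_recurrence\<close> over \<open>triples r\<close>.
  Terms with c - 1 and the same a and b assemble to right factors at r - 2; the three terms of
  \<open>B_right_factor\<close> assemble to one at r - 1.\<close>

lemma right_factor_recurrence:
  assumes "r \<le> Suc n"
  shows "qint (int n + 1) \<cdot> right_factor \<sigma> (Suc n) r =
    qint (int n + 1 - int r) \<cdot> (Kinv * right_factor \<sigma> n r)
    + (if r \<ge> 2 then if even (n + r) then (q * \<sigma> * qint (int n + 2 - int r))
        \<cdot> (Kinv * right_factor \<sigma> n (r - 2)) else 0 else 0)
    + (if r \<ge> 1 then B \<sigma> * right_factor \<sigma> n (r - 1) else 0)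
    - (if r \<ge> 2 then if even n then (q * \<sigma> * qint (int n)) \<cdot> right_factor \<sigma> (n - 1) (r - 2) else 0
        else 0)"
proof -
  define f1 f2 f3 f4 f5 f6 where
    "f1 a b c = pbw \<sigma> a
        (smult (qint (int n + 1 - int r) * q powi (- 2 * int a))
        ([:0, 1:] * cartan_part \<sigma> n a b c)) b"
    and "f2 a b c = pbw \<sigma> a (if c > 0 \<and> even (n + r)
        then smult (q * \<sigma> * qint (int n + 2 - int r) * q powi (- 2 * int a))
        ([:0, 1:] * cartan_part \<sigma> n a b (c - 1)) else 0) b"
    and "f3 a b c = pbw \<sigma> a (smult (qint (int a)) (cartan_part \<sigma> n (a - 1) b c)) b"
    and "f4 a b c = pbw \<sigma> a
        (smult (q powi (- 2 * int a) * qint (int b))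
        (pcompose (cartan_part \<sigma> n a (b - 1) c) [:0, q powi (- 2):])) b"
    and "f5 a b c = pbw \<sigma> a
        (if c > 0 then smult (\<sigma> / (q - 1 / q)) ([:- (q powi (- int a)), 0, q powi (- 3 * int a):]
        * cartan_part \<sigma> n (Suc a) b (c - 1)) else 0) b"
    and "f6 a b c = pbw \<sigma> a (if c > 0 \<and> even n
        then smult (q * \<sigma> * qint (int n)) (cartan_part \<sigma> (n - 1) a b (c - 1)) else 0) b"
    for a b c
  have "qint (int n + 1) \<cdot> right_factor \<sigma> (Suc n) r
      = (\<Sum>(a, b, c)\<in>triples r. pbw \<sigma> a (smult (qint (int n + 1)) (cartan_part \<sigma> (Suc n) a b c)) b)"
    by (simp only: right_factor_def scaleq_sum_right prod.case_distrib[of "\<lambda>x. _ \<cdot> x"] pbw_smult)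
  also have "\<dots> = (\<Sum>(a, b, c)\<in>triples r. f1 a b c + f2 a b c + (f3 a b c + f4 a b c + f5 a b c)
      - f6 a b c)"
  proof (intro sum.cong refl, clarify)
    fix a b c assume "(a, b, c) \<in> triples r"
    then have "a + b + 2 * c = r" by (simp add: triples_def)
    from cartan_part_recurrence[OF this assms]
    show "pbw \<sigma> a (smult (qint (int n + 1)) (cartan_part \<sigma> (Suc n) a b c)) b
        = f1 a b c + f2 a b c + (f3 a b c + f4 a b c + f5 a b c) - f6 a b c"
      unfolding f1_def f2_def f3_def f4_def f5_def f6_def
      by (simp only: pbw_add pbw_diff add.assoc)
  qed
  also have "\<dots> = (\<Sum>(a, b, c)\<in>triples r. f1 a b c) + (\<Sum>(a, b, c)\<in>triples r. f2 a b c)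
      + (\<Sum>(a, b, c)\<in>triples r. f3 a b c + f4 a b c + f5 a b c) - (\<Sum>(a, b, c)\<in>triples r. f6 a b c)"
    by (simp add: split_def sum.distrib sum_subtractf)
  also have "(\<Sum>(a, b, c)\<in>triples r. f1 a b c)
      = qint (int n + 1 - int r) \<cdot> (Kinv * right_factor \<sigma> n r)"
    by (simp only: f1_def Kinv_right_factor scaleq_sum_right prod.case_distrib[of "\<lambda>x. _ \<cdot> x"]
        pbw_smult scaleq_scaleq)
  also have "(\<Sum>(a, b, c)\<in>triples r. f2 a b c)
      = (if r \<ge> 2 then if even (n + r) then (q * \<sigma> * qint (int n + 2 - int r))
      \<cdot> (Kinv * right_factor \<sigma> n (r - 2)) else 0 else 0)"
  proof -
    have 0: "f2 a b 0 = 0" for a b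
      by (simp add: f2_def)
    have 1: "f2 a b (Suc c) = (if even (n + r) then (q * \<sigma> * qint (int n + 2 - int r)) \<cdot>
        pbw \<sigma> a (smult (q powi (- 2 * int a)) ([:0, 1:] * cartan_part \<sigma> n a b c)) b else 0)"
      for a b c
      by (simp add: f2_def pbw_smult scaleq_scaleq del: mult_pCons_left smult_pCons)
    show ?thesis
      unfolding sum_triples_shift_3[of f2, OF 0] 1 Kinv_right_factor
      by (simp add: scaleq_sum_right split_def del: mult_pCons_left smult_pCons)
  qed
  also have "(\<Sum>(a, b, c)\<in>triples r. f3 a b c + f4 a b c + f5 a b c)
      = (if r \<ge> 1 then B \<sigma> * right_factor \<sigma> n (r - 1) else 0)"
  \<comment> \<open>For r = 0 only the triple (0, 0, 0) occurs, and its terms vanish because [0] = 0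
    and c = 0.\<close>
  proof (cases r)
    case 0
    then have "triples r = {(0, 0, 0)}" by (auto simp: triples_def)
    then show ?thesis using 0 by (simp add: f3_def f4_def f5_def)
  next
    case (Suc k)
    have "1 \<le> r" "r - 1 = k" "triples r = triples (Suc k)" using Suc by simp_all
    then show ?thesis by (simp only: B_right_factor f3_def f4_def f5_def if_True)
  qed
  also have "(\<Sum>(a, b, c)\<in>triples r. f6 a b c)
      = (if r \<ge> 2 then if even n then (q * \<sigma> * qint (int n)) \<cdot> right_factor \<sigma> (n - 1) (r - 2)
      else 0 else 0)"
    by (subst sum_triples_shift_3)
        (simp_all add: f6_def right_factor_def scaleq_sum_right split_def pbw_smult)
  finally show ?thesis .
qed

section \<open>The coproduct of the divided powers\<close>

lemma B_Bdiv0: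
  "B \<sigma> * Bdiv0 \<sigma> n = qint (int n + 1) \<cdot> Bdiv0 \<sigma> (Suc n)
     + (if even n then (q * \<sigma> * qint (int n)) \<cdot> Bdiv0 \<sigma> (n - 1) else 0)"
proof -
  define x where "x = B \<sigma>"
  define s where "s m = q * \<sigma> * (qint m)\<^sup>2" for m
  \<comment> \<open>Both parities rest on this product: up to quantum factorials the odd power is x
    P(k), and the positive even one is x^2 P(k).\<close>
  define P where "P k = (\<Prod>j\<leftarrow>[1..<Suc k]. x\<^sup>2 - s (2 * int j) \<cdot> 1)" for k
  have P_Suc: "P (Suc k) = P k * (x\<^sup>2 - s (2 * int (Suc k)) \<cdot> 1)" for k
    unfolding P_def by (subst upt_Suc_append) simp_all
  have P_x: "P k * x = x * P k" for k
  proof (induction k)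
    case (Suc k)
    have "(x\<^sup>2 - c \<cdot> 1) * x = x * (x\<^sup>2 - c \<cdot> 1)" for c
      by (simp add: left_diff_distrib right_diff_distrib mult_scaleq_left mult_scaleq_right
          power2_eq_square mult.assoc)
    then show ?case
      by (simp only: P_Suc mult.assoc) (simp only: Suc flip: mult.assoc)
  qed (simp add: P_def)
  \<comment> \<open>The factor j = 1 is x^2 since [0] = 0, and the others are those of
    \<open>P k\<close> shifted by one.\<close>
  have "(\<Prod>j\<leftarrow>[1..<Suc (Suc k)]. x\<^sup>2 - s (2 * int j - 2) \<cdot> 1) = x\<^sup>2 * P k" for k
  proof -
    have "[1..<Suc (Suc k)] = 1 # map Suc [1..<Suc k]"
      unfolding map_Suc_upt by (subst upt_conv_Cons) auto
    then show ?thesis by (simp add: P_def s_def o_def algebra_simps)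
  qed
  then have ev: "Bdiv0 \<sigma> (2 * Suc k) = (1 / qfact (2 * Suc k)) \<cdot> (x\<^sup>2 * P k)" for k
    by (simp add: Bdiv0_def x_def s_def)
  have od: "Bdiv0 \<sigma> (Suc (2 * k)) = (1 / qfact (Suc (2 * k))) \<cdot> (x * P k)" for k
    by (simp add: Bdiv0_def x_def s_def P_def)
  have fact: "1 / qfact m = qint (int m + 1) * (1 / qfact (Suc m))" for m
    using qfact_nonzero[of "Suc m"] by (simp add: qfact_Suc)
  show ?thesis
  proof (cases "even n")
    case False
    then obtain k where n: "n = Suc (2 * k)" by (elim oddE) simp
    have "B \<sigma> * Bdiv0 \<sigma> n = (1 / qfact n) \<cdot> (x\<^sup>2 * P k)"
      unfolding n od by (simp add: mult_scaleq_right x_def power2_eq_square mult.assoc)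
    also have "\<dots> = qint (int n + 1) \<cdot> Bdiv0 \<sigma> (2 * Suc k)"
      unfolding ev fact[of n] scaleq_scaleq by (simp add: n)
    finally show ?thesis using False by (simp add: n)
  next
    case True
    then obtain k where n: "n = 2 * k" by (elim evenE)
    show ?thesis
    proof (cases k)
      case 0
      then show ?thesis using od[of 0] qint_nonzero[of 1]
        by (simp add: n P_def x_def Bdiv0_def scaleq_scaleq scaleq_one qfact_def)
    next
      case (Suc m)
      have n': "n = 2 * Suc m" "n - 1 = Suc (2 * m)" "Suc n = Suc (2 * Suc m)"
        by (simp_all add: n Suc)
      \<comment> \<open>Since n = 2(m + 1), the last factor of \<open>P (Suc m)\<close> is x^2 -
        s(n); its scalar part is the source of the lower term for even n.\<close>
      have "x * P (Suc m) = x * (x\<^sup>2 * P m) - s (int n) \<cdot> (x * P m)"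
      proof -
        have "P m * x\<^sup>2 = x\<^sup>2 * P m"
          by (metis P_x mult.assoc power2_eq_square)
        then show ?thesis
          by (simp add: P_Suc right_diff_distrib mult_scaleq_right n' mult.assoc)
      qed
      then have "x * (x\<^sup>2 * P m) = x * P (Suc m) + s (int n) \<cdot> (x * P m)"
        by simp
      moreover have "B \<sigma> * Bdiv0 \<sigma> n = (1 / qfact n) \<cdot> (x * (x\<^sup>2 * P m))"
        unfolding n'(1) ev by (simp add: mult_scaleq_right x_def)
      moreover have "(1 / qfact n) \<cdot> (x * P (Suc m)) = qint (int n + 1) \<cdot> Bdiv0 \<sigma> (Suc n)"
        unfolding n'(3) od unfolding fact[of n] scaleq_scaleq n'(3) ..
      moreover have "(1 / qfact n * s (int n)) \<cdot> (x * P m)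
          = (q * \<sigma> * qint (int n)) \<cdot> Bdiv0 \<sigma> (n - 1)"
      proof -
        have "int (n - 1) + 1 = int n" "Suc (n - 1) = n" using n' by simp_all
        then have "1 / qfact n * s (int n) = q * \<sigma> * qint (int n) * (1 / qfact (n - 1))"
          using fact[of "n - 1"] by (simp add: s_def power2_eq_square)
        then show ?thesis unfolding n'(2) od by (simp add: scaleq_scaleq)
      qed
      ultimately show ?thesis using True by (simp add: scaleq_add_right scaleq_scaleq)
    qed
  qed
qed

section \<open>The coproduct of \<open>B\<close>\<close>

lemma comult_Kinv: "comult Kinv = Kinv \<otimes> Kinv"
proof -
  have hom: "comult (x * y) = comult x * comult y" "comult 1 = 1" for x y
    using comult_hom by (auto simp: algebra_hom_def)
  \<comment> \<open>Uniqueness of inverses: both sides invert \<open>K \<otimes> K\<close>.\<close>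
  have "comult Kinv = (Kinv \<otimes> Kinv) * (K \<otimes> K) * comult Kinv"
    by (simp add: tensor_mult Kinv_K tensor_one)
  also have "\<dots> = (Kinv \<otimes> Kinv) * comult (K * Kinv)"
    by (simp only: hom comult_K mult.assoc)
  finally show ?thesis by (simp add: K_Kinv hom)
qed

text \<open>The factor K in the coproduct of E is cancelled by the \<open>Kinv\<close> in
  \<open>Echeck\<close>, so \<open>Echeck\<close> and \<open>F\<close> have coproducts of the same
  shape.\<close>

lemma comult_B: "comult (B \<sigma>) = B \<sigma> \<otimes> Kinv + 1 \<otimes> B \<sigma>"
proof -
  have hom: "comult (x + y) = comult x + comult y" "comult (x * y) = comult x * comult y"
    "comult (c \<cdot> x) = c \<cdot> comult x" for x y c
    using comult_hom by (auto simp: algebra_hom_def)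
  have "comult (Echeck \<sigma>) = Echeck \<sigma> \<otimes> Kinv + 1 \<otimes> Echeck \<sigma>"
    by (simp add: Echeck_def hom comult_E comult_Kinv distrib_right tensor_mult K_Kinv
        scaleq_add_right tensor_scaleq_left tensor_scaleq_right)
  then show ?thesis
    by (simp add: B_def hom comult_F tensor_add_left tensor_add_right)
qed

lemma tensor_zero_left [simp]: "0 \<otimes> b = 0"
  using tensor_scaleq_left[of 0 0 b] by simp

section \<open>Sums padded by zeros to a common range, and the induction on n\<close>

lemma sum_shift_2:
  "(\<Sum>r = 0..Suc n. if r \<ge> 2 then f r else 0) = (\<Sum>r<n. f (r + 2) :: 'a::comm_monoid_add)"
  by (induction n) simp_all

lemma sum_shift_1:
  "(\<Sum>r = 0..Suc n. if r \<ge> 1 then f r else 0) = (\<Sum>r = 0..n. f (Suc r) :: 'a::comm_monoid_add)"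
  by (induction n) simp_all

lemma tensor_diff_right: "a \<otimes> (b - c) = a \<otimes> b - a \<otimes> c"
  using tensor_add_right[of a "b - c" c] by (simp add: eq_diff_eq)

text \<open>Apply \<open>comult\<close> to \<open>B_Bdiv0\<close>, expand with
  \<open>comult_B\<close>, and compare the terms with left factor
  \<open>Bdiv0 \<sigma> (n - r)\<close>. The induction is strong because the recurrence reaches back
  two steps.\<close>

lemma comult_Bdiv0: "comult (Bdiv0 \<sigma> n) = (\<Sum>r = 0..n. Bdiv0 \<sigma> (n - r) \<otimes> right_factor \<sigma> n r)"
proof (induction n rule: less_induct)
  case (less n)
  have hom: "comult (x + y) = comult x + comult y" "comult (x * y) = comult x * comult y"
    "comult (c \<cdot> x) = c \<cdot> comult x" "comult 1 = 1" for x y c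
    using comult_hom by (auto simp: algebra_hom_def)
  have hom_0: "comult 0 = 0" using hom(3)[of 0 0] by simp
  show ?case
  proof (cases n)
    case 0
    have "triples 0 = {(0, 0, 0)}" by (auto simp: triples_def)
    then show ?thesis
      by (simp add: 0 Bdiv0_def scaleq_one hom right_factor_def pbw_def cartan_part_def
          q_exponent_def divpow_def tensor_one
          Kinv_poly_pCons)
  next
    case (Suc k)
    let ?b = "Bdiv0 \<sigma>"
    have IH: "comult (?b k) = (\<Sum>r = 0..k. ?b (k - r) \<otimes> right_factor \<sigma> k r)"
      using less Suc by simp
    \<comment> \<open>For k = 0 the predecessor truncates, but both sides are zero: the coefficient
      is [0] and the sum is empty.\<close>
    have IH': "(if even k then (q * \<sigma> * qint (int k)) \<cdot> comult (?b (k - 1)) else 0)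
        = (\<Sum>r<k. ?b (k - 1 - r)
            \<otimes> (if even k then (q * \<sigma> * qint (int k)) \<cdot> right_factor \<sigma> (k - 1) r else 0))"
    proof (cases k)
      case (Suc l)
      then have "{0..k - 1} = {..<k}" by auto
      moreover have "comult (?b (k - 1))
          = (\<Sum>r = 0..k - 1. ?b (k - 1 - r) \<otimes> right_factor \<sigma> (k - 1) r)"
        using less Suc \<open>n = Suc k\<close> by simp
      ultimately show ?thesis
        by (simp add: scaleq_sum_right tensor_scaleq_right)
    qed simp
    have nz: "qint (int k + 1) \<noteq> 0" using qint_nonzero[of "Suc k"] by (simp add: add.commute)
    have "qint (int k + 1) \<cdot> comult (?b (Suc k))
        + (if even k then (q * \<sigma> * qint (int k)) \<cdot> comult (?b (k - 1)) else 0)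
            = comult (B \<sigma> * ?b k)"
      unfolding B_Bdiv0 by (simp add: hom hom_0)
    also have "\<dots> = (\<Sum>r = 0..k. (B \<sigma> * ?b (k - r)) \<otimes> (Kinv * right_factor \<sigma> k r) + ?b (k - r)
        \<otimes> (B \<sigma> * right_factor \<sigma> k r))"
      by (simp add: hom comult_B IH sum_distrib_left distrib_right tensor_mult)
    also have "\<dots> = (\<Sum>r = 0..k. ?b (Suc k - r)
        \<otimes> (qint (int k + 1 - int r) \<cdot> (Kinv * right_factor \<sigma> k r)))
        + (\<Sum>r = 0..k. ?b (k - r - 1)
            \<otimes> (if even (k + r) then (q * \<sigma> * qint (int k - int r)) \<cdot> (Kinv * right_factor \<sigma> k r)
            else 0))
        + (\<Sum>r = 0..k. ?b (k - r) \<otimes> (B \<sigma> * right_factor \<sigma> k r))"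
      unfolding sum.distrib[symmetric]
    proof (intro sum.cong refl)
      fix r assume "r \<in> {0..k}"
      then have "int (k - r) = int k - int r" "Suc k - r = Suc (k - r)"
         "even (k - r) \<longleftrightarrow> even (k + r)"
        by auto
      then show "(B \<sigma> * ?b (k - r)) \<otimes> (Kinv * right_factor \<sigma> k r) + ?b (k - r)
          \<otimes> (B \<sigma> * right_factor \<sigma> k r)
        = ?b (Suc k - r) \<otimes> (qint (int k + 1 - int r) \<cdot> (Kinv * right_factor \<sigma> k r))
        + ?b (k - r - 1) \<otimes> (if even (k + r) then (q * \<sigma> * qint (int k - int r))
            \<cdot> (Kinv * right_factor \<sigma> k r) else 0)
        + ?b (k - r) \<otimes> (B \<sigma> * right_factor \<sigma> k r)"
        by (simp add: B_Bdiv0 tensor_add_left tensor_scaleq_left tensor_scaleq_right diff_add_eq)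
    qed
    \<comment> \<open>The added summand r = k + 1 has coefficient [0].\<close>
    also have "(\<Sum>r = 0..k. ?b (Suc k - r)
        \<otimes> (qint (int k + 1 - int r) \<cdot> (Kinv * right_factor \<sigma> k r)))
        = (\<Sum>r = 0..Suc k. ?b (Suc k - r)
            \<otimes> (qint (int k + 1 - int r) \<cdot> (Kinv * right_factor \<sigma> k r)))"
      by simp
    \<comment> \<open>The summand r = k, where \<open>k - r - 1\<close> truncates, has coefficient
      [0] and is dropped before the shift by 2.\<close>
    also have "(\<Sum>r = 0..k. ?b (k - r - 1)
        \<otimes> (if even (k + r) then (q * \<sigma> * qint (int k - int r)) \<cdot> (Kinv * right_factor \<sigma> k r)
        else 0))
      = (\<Sum>r<k. ?b (k - r - 1)
          \<otimes> (if even (k + r) then (q * \<sigma> * qint (int k - int r)) \<cdot> (Kinv * right_factor \<sigma> k r)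
          else 0))"
      by (simp add: atLeast0AtMost lessThan_Suc_atMost[symmetric])
    also have "\<dots> = (\<Sum>r = 0..Suc k. ?b (Suc k - r)
        \<otimes> (if r \<ge> 2 then if even (k + r) then (q * \<sigma> * qint (int k + 2 - int r))
        \<cdot> (Kinv * right_factor \<sigma> k (r - 2)) else 0 else 0))"
      unfolding if_distrib[of "\<lambda>x. _ \<otimes> (x :: U)" "_ \<ge> _"] tensor_zero_right sum_shift_2
    proof (intro sum.cong refl)
      fix r
      have "int k + 2 - int (r + 2) = int k - int r" "Suc k - (r + 2) = k - r - 1" "r + 2 - 2 = r"
        "even (k + (r + 2)) \<longleftrightarrow> even (k + r)"
        by simp_all
      then show "?b (k - r - 1)
          \<otimes> (if even (k + r) then (q * \<sigma> * qint (int k - int r)) \<cdot> (Kinv * right_factor \<sigma> k r)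
          else 0)
        = ?b (Suc k - (r + 2))
            \<otimes> (if even (k + (r + 2)) then (q * \<sigma> * qint (int k + 2 - int (r + 2)))
            \<cdot> (Kinv * right_factor \<sigma> k (r + 2 - 2)) else 0)"
        by (simp only:)
    qed
    also have "(\<Sum>r = 0..k. ?b (k - r) \<otimes> (B \<sigma> * right_factor \<sigma> k r))
      = (\<Sum>r = 0..Suc k. ?b (Suc k - r) \<otimes> (if r \<ge> 1 then B \<sigma> * right_factor \<sigma> k (r - 1) else 0))"
      unfolding if_distrib[of "\<lambda>x. _ \<otimes> (x :: U)" "_ \<ge> _"] tensor_zero_right sum_shift_1 by simp
    finally have "qint (int k + 1) \<cdot> comult (?b (Suc k)) =
         (\<Sum>r = 0..Suc k. ?b (Suc k - r) \<otimes> (qint (int k + 1 - int r) \<cdot> (Kinv * right_factor \<sigma> k r)))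
       + (\<Sum>r = 0..Suc k. ?b (Suc k - r)
           \<otimes> (if r \<ge> 2 then if even (k + r) then (q * \<sigma> * qint (int k + 2 - int r))
           \<cdot> (Kinv * right_factor \<sigma> k (r - 2)) else 0 else 0))
       + (\<Sum>r = 0..Suc k. ?b (Suc k - r) \<otimes> (if r \<ge> 1 then B \<sigma> * right_factor \<sigma> k (r - 1) else 0))
       - (if even k then (q * \<sigma> * qint (int k)) \<cdot> comult (?b (k - 1)) else 0)"
      unfolding eq_diff_eq .
    also have "(if even k then (q * \<sigma> * qint (int k)) \<cdot> comult (?b (k - 1)) else 0)
      = (\<Sum>r = 0..Suc k. ?b (Suc k - r)
          \<otimes> (if r \<ge> 2 then if even k then (q * \<sigma> * qint (int k)) \<cdot> right_factor \<sigma> (k - 1) (r - 2)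
          else 0 else 0))"
      unfolding IH' if_distrib[of "\<lambda>x. _ \<otimes> (x :: U)" "_ \<ge> _"] tensor_zero_right sum_shift_2
      by (simp cong: if_cong)
    also have "(\<Sum>r = 0..Suc k. ?b (Suc k - r)
        \<otimes> (qint (int k + 1 - int r) \<cdot> (Kinv * right_factor \<sigma> k r)))
       + (\<Sum>r = 0..Suc k. ?b (Suc k - r)
           \<otimes> (if r \<ge> 2 then if even (k + r) then (q * \<sigma> * qint (int k + 2 - int r))
           \<cdot> (Kinv * right_factor \<sigma> k (r - 2)) else 0 else 0))
       + (\<Sum>r = 0..Suc k. ?b (Suc k - r) \<otimes> (if r \<ge> 1 then B \<sigma> * right_factor \<sigma> k (r - 1) else 0))
       - (\<Sum>r = 0..Suc k. ?b (Suc k - r)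
           \<otimes> (if r \<ge> 2 then if even k then (q * \<sigma> * qint (int k)) \<cdot> right_factor \<sigma> (k - 1) (r - 2)
           else 0 else 0))
       = (\<Sum>r = 0..Suc k. ?b (Suc k - r) \<otimes> (qint (int k + 1) \<cdot> right_factor \<sigma> (Suc k) r))"
      unfolding sum.distrib[symmetric] sum_subtractf[symmetric] tensor_add_right[symmetric]
          tensor_diff_right[symmetric]
      by (intro sum.cong refl arg_cong[where f = "\<lambda>x. _ \<otimes> x"] right_factor_recurrence[symmetric])
          simp
    also have "\<dots> = qint (int k + 1) \<cdot> (\<Sum>r = 0..Suc k. ?b (Suc k - r) \<otimes> right_factor \<sigma> (Suc k) r)"
      by (simp only: tensor_scaleq_right scaleq_sum_right)
    finally show ?thesis
      unfolding Suc by (rule scaleq_cancel[OF nz])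
  qed
qed

section \<open>Matching the stated form of the sum\<close>

lemma sum_triples:
  "(\<Sum>(a, b, c)\<in>triples r. f a b c)
    = (\<Sum>c = 0..r div 2. \<Sum>a = 0..r - 2 * c. f a (r - 2 * c - a) c)"
  unfolding sum.Sigma[OF finite_atLeastAtMost ballI[OF finite_atLeastAtMost]]
  by (rule sum.reindex_bij_witness[where i = "\<lambda>(c, a). (a, r - 2 * c - a, c)"
        and j = "\<lambda>(a, b, c). (c, a)"]) (auto simp: triples_def)

lemma Kpow_diff: "r \<le> n \<Longrightarrow> Kpow (int r - int n) = Kinv ^ (n - r)"
  by (cases "r = n") (auto simp: Kpow_def nat_diff_distrib)

lemma two_times_choose_two: "int ((2 * c) choose 2) = int c * (2 * int c - 1)"
  by (cases c) (auto simp: choose_two algebra_simps)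

lemma Suc_two_times_choose_two: "int ((2 * c + 1) choose 2) = int c * (2 * int c + 1)"
  by (simp add: choose_two algebra_simps)

lemma pbw_cartan_part:
  assumes "r \<le> n" "c \<le> r div 2" "a \<le> r - 2 * c"
  shows "pbw \<sigma> a (cartan_part \<sigma> n a (r - 2 * c - a) c) (r - 2 * c - a) =
    (q powi (int ((2 * c + n mod 2) choose 2) + (int r - 2 * int c) * (int r - int n)
        - int a * (int r - 2 * int c - int a)) * (q * \<sigma>) ^ c) \<cdot>
      (divpow (Echeck \<sigma>) a * hbinom (- ((int r - (if even n then 2 else 1)) div 2)) c
        * Kpow (int r - int n) * divpow F (r - 2 * c - a))"
proof -
  define b where "b = r - 2 * c - a"
  have r: "a + b + 2 * c = r" "int r = int a + int b + 2 * int c"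
    using assms by (auto simp: b_def)
  have "int ((2 * c + n mod 2) choose 2) = int c * (2 * int c - 1) + 2 * int c * int (n mod 2)"
  proof (cases "even n")
    case True
    then show ?thesis using two_times_choose_two[of c] by (simp add: even_iff_mod_2_eq_zero)
  next
    case False
    then show ?thesis using Suc_two_times_choose_two[of c]
      by (simp add: odd_iff_mod_2_eq_one algebra_simps)
  qed
  then have "q_exponent n (int a) (int b) (int c) = int ((2 * c + n mod 2) choose 2)
      + (int r - 2 * int c) * (int r - int n) - int a * (int r - 2 * int c - int a)"
    by (simp add: q_exponent_def r algebra_simps)
  \<comment> \<open>The two polynomials commute, so the power of K can be placed to the right of the
    bracket.\<close>
  moreover have "Kinv_poly (monom 1 (n - r) * hpoly A c) = hbinom A c * Kpow (int r - int n)" for A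
    by (simp only: mult.commute[of "monom 1 _"] Kinv_poly_mult Kinv_poly_monom hbinom_eq
        Kpow_diff[OF assms(1)])
  ultimately show ?thesis
    unfolding b_def[symmetric] cartan_part_def r(1) pbw_smult
        by (simp only: pbw_def h_param_def mult.assoc)
qed

theorem theorem4p2:
  fixes \<sigma> :: Qq and n :: nat
  assumes "\<sigma> \<noteq> 0"
  shows
    "(even n \<longrightarrow>
       comult (Bdiv0 \<sigma> n) =
         (\<Sum>r = 0..n. Bdiv0 \<sigma> (n - r) \<otimes>
           (\<Sum>c = 0..r div 2. \<Sum>a = 0..r - 2 * c.
              (q powi (int ((2 * c) choose 2) + (int r - 2 * int c) * (int r - int n)
                         - int a * (int r - 2 * int c - int a))
                 * (q * \<sigma>) ^ c) \<cdot>
              (divpow (Echeck \<sigma>) a * hbinom (- ((int r - 2) div 2)) c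
                 * Kpow (int r - int n) * divpow F (r - 2 * c - a)))))
     \<and> (odd n \<longrightarrow>
       comult (Bdiv0 \<sigma> n) =
         (\<Sum>r = 0..n. Bdiv0 \<sigma> (n - r) \<otimes>
           (\<Sum>c = 0..r div 2. \<Sum>a = 0..r - 2 * c.
              (q powi (int ((2 * c + 1) choose 2) + (int r - 2 * int c) * (int r - int n)
                         - int a * (int r - 2 * int c - int a))
                 * (q * \<sigma>) ^ c) \<cdot>
              (divpow (Echeck \<sigma>) a * hbinom (- ((int r - 1) div 2)) c
                 * Kpow (int r - int n) * divpow F (r - 2 * c - a)))))"
proof -
  \<comment> \<open>One formula covers both parities; evaluating \<open>n mod 2\<close> and the
    conditional yields the two cases.\<close>
  have "comult (Bdiv0 \<sigma> n) = (\<Sum>r = 0..n. Bdiv0 \<sigma> (n - r) \<otimes>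
      (\<Sum>c = 0..r div 2. \<Sum>a = 0..r - 2 * c.
        (q powi (int ((2 * c + n mod 2) choose 2) + (int r - 2 * int c) * (int r - int n)
            - int a * (int r - 2 * int c - int a)) * (q * \<sigma>) ^ c) \<cdot>
          (divpow (Echeck \<sigma>) a * hbinom (- ((int r - (if even n then 2 else 1)) div 2)) c
            * Kpow (int r - int n) * divpow F (r - 2 * c - a))))"
    unfolding comult_Bdiv0 right_factor_def sum_triples
    by (intro sum.cong refl arg_cong[where f = "\<lambda>x. _ \<otimes> x"] pbw_cartan_part) auto
  then show ?thesis
    by (simp add: even_iff_mod_2_eq_zero odd_iff_mod_2_eq_one)
qed

end
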